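(* Let $\mathcal M,\mathcal N$ be $C^2$-manifolds of dimensions $m,n$, let $\mathcal K\subset\mathcal N$ be a submanifold with corners of dimension $k$, let $f\in C^2(\mathcal M,\mathbb R)$, $g\in C^2(\mathcal M,\mathcal N)$, and $\mathcal F=\{p\in\mathcal M : g(p)\in\mathcal K\}$. Suppose that $p_*\in\mathcal F$ is a local minimizer of $f$ over $\mathcal F$ and that the constraint qualification (ZKRCQ) $$\operatorname{image} g'(p_* ) - T^i_{g(p_* )}\mathcal K = T_{g(p_* )}\mathcal N$$ holds. Then there exists $\mu\in T^*_{g(p_* )}\mathcal N$ such that $$f'(p_* )+\mu\, g'(p_* )=0 \ \text{ in } T^*_{p_*}\mathcal M,\qquad \mu\in\bigl(T^i_{g(p_* )}\mathcal K\bigr)^\circ. \quad (\ast)$$ Moreover, the set $\Lambda(p_* )=\{\mu\in T^*_{g(p_* )}\mathcal N : (\ast)\text{ holds}\}$ is compact. If in addition (LICQ) $$\operatorname{image} g'(p_* ) - T^0_{g(p_* )}\mathcal K = T_{g(p_* )}\mathcal N$$ holds, then $\Lambda(p_* )$ is a singleton.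
   Context: Manifolds are finite-dimensional and without boundary. A subset $\mathcal K\subset\mathcal N$ is a submanifold with corners of dimension $k$ ($0\le k\le n$) if for each $q\in\mathcal K$ there are a chart $(\mathcal U,\psi)$ of $\mathcal N$ with $q\in\mathcal U$, $\psi(q)=0$, an integer $0\le\ell\le k$, and a surjective linear map $A:\mathbb R^k\times\{0\}^{n-k}\to\mathbb R^\ell$ such that $\psi(\mathcal K\cap\mathcal U)=\{x\in\psi(\mathcal U) : Wx=0,\ Ax\le 0\}$, where $Wx=(x_{k+1},\dots,x_n)^{\mathsf T}$ and $\le$ is componentwise. Such a chart is called an adapted chart centered at $q$. The map $A$ is identified with the matrix $[\widehat A\ \ 0]\in\mathbb R^{\ell\times n}$, $\widehat A\in\mathbb R^{\ell\times k}$. For $v\in T_q\mathcal N$ let $v_\psi\in\mathbb R^n$ denote its representative in the chart $\psi$. For $q\in\mathcal K$ and an adapted chart $\psi$ centered at $q$, the set of inner tangent vectors is $T^i_q\mathcal K=\{v\in T_q\mathcal N : Wv_\psi=0,\ Av_\psi\le0\}$ and $T^0_q\mathcal K=\{v\in T_q\mathcal N : Wv_\psi=0,\ Av_\psi=0\}$; these do not depend on the adapted chart. For a subset $S$ of a normed vector space $V$, the polar cone is $S^\circ=\{v^*\in V^* : \langle v^*,s\rangle\le0\ \forall s\in S\}$. $\mu\,g'(p_* )$ denotes the composition of the linear form $\mu$ with the linear map $g'(p_* ):T_{p_*}\mathcal M\to T_{g(p_* )}\mathcal N$. For sets $S_1,S_2$ in a vector space, $S_1-S_2=\{s_1-s_2\}$.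 *)

theory Defs
  imports "HOL-Analysis.Analysis"
begin

text \<open>
  R^n is the subspace of the bounded real sequences (with the sup norm) whose terms
  vanish from index n on.  In this way every dimension, 0 included, is a natural number and the
  coordinate subspace R^k x {0}^(n-k) of R^n is literally R^k.
  Coordinates are numbered from 0, so the coordinates k+1, ..., n of the
  mathematical text are those with index i such that k \<le> i < n.
\<close>

type_synonym rseq = "nat \<Rightarrow>\<^sub>C real"

definition Rn :: "nat \<Rightarrow> rseq set" where
  "Rn n = {x. \<forall>i\<ge>n. apply_bcontfun x i = 0}"

text \<open>
  Class C^r on a relatively open subset S of R^n.  Derivatives are taken within
  S, so they are determined on R^n only (see the lemma below) and are never
  evaluated elsewhere.  In finite dimension it is equivalent to ask for C^r of the derivative as an
  operator-valued map or of all directional derivatives.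
\<close>

fun Ck_on :: "nat \<Rightarrow> nat \<Rightarrow> rseq set \<Rightarrow> (rseq \<Rightarrow> 'a::real_normed_vector) \<Rightarrow> bool" where
  "Ck_on 0 n S F \<longleftrightarrow> continuous_on S F"
| "Ck_on (Suc r) n S F \<longleftrightarrow>
     (\<exists>F'. (\<forall>x\<in>S. (F has_derivative F' x) (at x within S)) \<and>
           (\<forall>v\<in>Rn n. Ck_on r n S (\<lambda>x. F' x v)))"

lemma has_derivative_within_unique_on_Rn:
  fixes F :: "rseq \<Rightarrow> 'a::real_normed_vector"
  assumes S: "openin (top_of_set (Rn n)) S" and x: "x \<in> S" and v: "v \<in> Rn n"
    and D: "(F has_derivative D) (at x within S)" and E: "(F has_derivative E) (at x within S)"
  shows "D v = E v"
proof -
  obtain T where T: "open T" "S = Rn n \<inter> T"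
    using S by (auto simp: openin_open)
  define line where "line = (\<lambda>t::real. x + t *\<^sub>R v)"
  have Rn: "line t \<in> Rn n" for t
    using x v T by (auto simp: line_def Rn_def)
  have "open (line -` T)"
    unfolding line_def by (intro open_vimage T continuous_intros)
  moreover have "0 \<in> line -` T"
    using x T by (simp add: line_def)
  moreover have img: "line ` (line -` T) \<subseteq> S"
    using T Rn by auto
  have "((\<lambda>t. F (line t)) has_derivative (\<lambda>t. G (t *\<^sub>R v))) (at 0 within line -` T)"
    if G: "(F has_derivative G) (at x within S)" for G
  proof -
    have "(line has_derivative (\<lambda>t. t *\<^sub>R v)) (at 0 within line -` T)"
      unfolding line_def by (auto intro!: derivative_eq_intros)
    moreover have "(F has_derivative G) (at (line 0) within line ` (line -` T))"
      using has_derivative_subset[OF G img] by (simp add: line_def)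
    ultimately show ?thesis
      by (rule has_derivative_in_compose)
  qed
  ultimately have "((\<lambda>t. F (line t)) has_derivative (\<lambda>t. D (t *\<^sub>R v))) (at 0)"
    "((\<lambda>t. F (line t)) has_derivative (\<lambda>t. E (t *\<^sub>R v))) (at 0)"
    using D E by (metis at_within_open)+
  then have "(\<lambda>t. D (t *\<^sub>R v)) = (\<lambda>t. E (t *\<^sub>R v))"
    by (rule has_derivative_unique)
  then show ?thesis
    by (metis scaleR_one)
qed

text \<open>
  A chart is a pair of its domain and its coordinate map; the values of the coordinate map outside
  the domain are irrelevant.
\<close>

type_synonym 'p chart = "'p set \<times> ('p \<Rightarrow> rseq)"

abbreviation in_chart :: "'p chart \<Rightarrow> ('p \<Rightarrow> 'b) \<Rightarrow> rseq \<Rightarrow> 'b" where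
  "in_chart c h \<equiv> h \<circ> inv_into (fst c) (snd c)"

record 'p mfd =
  mdim :: nat
  mtop :: "'p topology"
  atlas :: "'p chart set"

definition top_chart :: "nat \<Rightarrow> 'p topology \<Rightarrow> 'p chart \<Rightarrow> bool" where
  "top_chart n X c \<longleftrightarrow>
     openin X (fst c) \<and>
     openin (top_of_set (Rn n)) (snd c ` fst c) \<and>
     homeomorphic_map (subtopology X (fst c)) (top_of_set (snd c ` fst c)) (snd c)"

definition C2_compatible :: "nat \<Rightarrow> 'p chart \<Rightarrow> 'p chart \<Rightarrow> bool" where
  "C2_compatible n c d \<longleftrightarrow>
     Ck_on 2 n (snd c ` (fst c \<inter> fst d)) (in_chart c (snd d)) \<and>
     Ck_on 2 n (snd d ` (fst c \<inter> fst d)) (in_chart d (snd c))"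

text \<open>The atlas is the maximal one, so that its elements are all the charts of the manifold.\<close>

definition C2_manifold :: "'p mfd \<Rightarrow> bool" where
  "C2_manifold M \<longleftrightarrow>
     Hausdorff_space (mtop M) \<and> second_countable (mtop M) \<and>
     (\<forall>c\<in>atlas M. top_chart (mdim M) (mtop M) c) \<and>
     (\<Union>c\<in>atlas M. fst c) = topspace (mtop M) \<and>
     (\<forall>c\<in>atlas M. \<forall>d\<in>atlas M. C2_compatible (mdim M) c d) \<and>
     (\<forall>c. top_chart (mdim M) (mtop M) c \<and> (\<forall>d\<in>atlas M. C2_compatible (mdim M) c d)
        \<longrightarrow> c \<in> atlas M)"

definition charts_at :: "'p mfd \<Rightarrow> 'p \<Rightarrow> 'p chart set" where
  "charts_at M p = {c \<in> atlas M. p \<in> fst c}"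

definition C2_function :: "'p mfd \<Rightarrow> ('p \<Rightarrow> real) \<Rightarrow> bool" where
  "C2_function M f \<longleftrightarrow> (\<forall>c\<in>atlas M. Ck_on 2 (mdim M) (snd c ` fst c) (in_chart c f))"

definition C2_map :: "'p mfd \<Rightarrow> 'q mfd \<Rightarrow> ('p \<Rightarrow> 'q) \<Rightarrow> bool" where
  "C2_map M N g \<longleftrightarrow>
     continuous_map (mtop M) (mtop N) g \<and>
     (\<forall>c\<in>atlas M. \<forall>d\<in>atlas N.
        Ck_on 2 (mdim M) (snd c ` (fst c \<inter> g -` fst d)) (in_chart c (snd d \<circ> g)))"

text \<open>
  A tangent vector at p is the family of its representatives in all charts around p, related by
  the derivatives of the chart transitions; v c is the representative in the chart c.
  Vector space operations are pointwise.
\<close>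

type_synonym 'p tvec = "'p chart \<Rightarrow> rseq"

definition tangent_space :: "'p mfd \<Rightarrow> 'p \<Rightarrow> 'p tvec set" where
  "tangent_space M p =
     {v. (\<forall>c\<in>charts_at M p. v c \<in> Rn (mdim M)) \<and>
         (\<forall>c\<in>charts_at M p. \<forall>d\<in>charts_at M p.
            v d = frechet_derivative (in_chart c (snd d))
                    (at (snd c p) within snd c ` (fst c \<inter> fst d)) (v c)) \<and>
         (\<forall>c. c \<notin> charts_at M p \<longrightarrow> v c = 0)}"

text \<open>
  Linear forms on the tangent space, extended by 0 to the whole type.  The topology of the function
  type is that of pointwise convergence; on the cotangent space, being finite-dimensional, it is the
  usual (norm) topology.
\<close>

definition cotangent_space :: "'p mfd \<Rightarrow> 'p \<Rightarrow> ('p tvec \<Rightarrow> real) set" where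
  "cotangent_space M p =
     {\<mu>. (\<forall>v\<in>tangent_space M p. \<forall>w\<in>tangent_space M p. \<mu> (\<lambda>c. v c + w c) = \<mu> v + \<mu> w) \<and>
         (\<forall>a. \<forall>v\<in>tangent_space M p. \<mu> (\<lambda>c. a *\<^sub>R v c) = a * \<mu> v) \<and>
         (\<forall>v. v \<notin> tangent_space M p \<longrightarrow> \<mu> v = 0)}"

definition differential :: "'p mfd \<Rightarrow> ('p \<Rightarrow> real) \<Rightarrow> 'p \<Rightarrow> 'p tvec \<Rightarrow> real" where
  "differential M f p v =
     (if v \<in> tangent_space M p
      then THE r. \<forall>c\<in>charts_at M p.
             r = frechet_derivative (in_chart c f) (at (snd c p) within snd c ` fst c) (v c)
      else 0)"

definition tangent_map :: "'p mfd \<Rightarrow> 'q mfd \<Rightarrow> ('p \<Rightarrow> 'q) \<Rightarrow> 'p \<Rightarrow> 'p tvec \<Rightarrow> 'q tvec" where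
  "tangent_map M N g p v =
     (THE w. w \<in> tangent_space N (g p) \<and>
        (\<forall>c\<in>charts_at M p. \<forall>d\<in>charts_at N (g p).
           w d = frechet_derivative (in_chart c (snd d \<circ> g))
                   (at (snd c p) within snd c ` (fst c \<inter> g -` fst d)) (v c)))"

text \<open>
  Only the restriction of A to R^k matters, where
  it is a surjection onto R^l.
\<close>

definition adapted_chart ::
  "'q mfd \<Rightarrow> nat \<Rightarrow> 'q set \<Rightarrow> 'q \<Rightarrow> 'q chart \<Rightarrow> nat \<Rightarrow> (rseq \<Rightarrow> rseq) \<Rightarrow> bool" where
  "adapted_chart N k K q c l A \<longleftrightarrow>
     c \<in> charts_at N q \<and> snd c q = 0 \<and> l \<le> k \<and>
     linear A \<and> A ` Rn k = Rn l \<and>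
     snd c ` (K \<inter> fst c) =
       {x \<in> snd c ` fst c. (\<forall>i. k \<le> i \<and> i < mdim N \<longrightarrow> apply_bcontfun x i = 0) \<and>
                           (\<forall>j<l. apply_bcontfun (A x) j \<le> 0)}"

definition submanifold_with_corners :: "'q mfd \<Rightarrow> nat \<Rightarrow> 'q set \<Rightarrow> bool" where
  "submanifold_with_corners N k K \<longleftrightarrow>
     k \<le> mdim N \<and> K \<subseteq> topspace (mtop N) \<and> (\<forall>q\<in>K. \<exists>c l A. adapted_chart N k K q c l A)"

text \<open>
  The conditions in the next two definitions do not depend on the adapted chart, so the existential
  quantifier amounts to evaluating them in any one adapted chart.
\<close>

definition inner_tangent :: "'q mfd \<Rightarrow> nat \<Rightarrow> 'q set \<Rightarrow> 'q \<Rightarrow> 'q tvec set" where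
  "inner_tangent N k K q =
     {v \<in> tangent_space N q. \<exists>c l A. adapted_chart N k K q c l A \<and>
        (\<forall>i. k \<le> i \<and> i < mdim N \<longrightarrow> apply_bcontfun (v c) i = 0) \<and>
        (\<forall>j<l. apply_bcontfun (A (v c)) j \<le> 0)}"

definition inner_tangent0 :: "'q mfd \<Rightarrow> nat \<Rightarrow> 'q set \<Rightarrow> 'q \<Rightarrow> 'q tvec set" where
  "inner_tangent0 N k K q =
     {v \<in> tangent_space N q. \<exists>c l A. adapted_chart N k K q c l A \<and>
        (\<forall>i. k \<le> i \<and> i < mdim N \<longrightarrow> apply_bcontfun (v c) i = 0) \<and>
        (\<forall>j<l. apply_bcontfun (A (v c)) j = 0)}"

definition tvec_set_minus :: "'q tvec set \<Rightarrow> 'q tvec set \<Rightarrow> 'q tvec set" where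
  "tvec_set_minus S\<^sub>1 S\<^sub>2 = {\<lambda>c. s\<^sub>1 c - s\<^sub>2 c | s\<^sub>1 s\<^sub>2. s\<^sub>1 \<in> S\<^sub>1 \<and> s\<^sub>2 \<in> S\<^sub>2}"

definition polar_cone :: "'q mfd \<Rightarrow> 'q \<Rightarrow> 'q tvec set \<Rightarrow> ('q tvec \<Rightarrow> real) set" where
  "polar_cone N q S = {\<mu> \<in> cotangent_space N q. \<forall>s\<in>S. \<mu> s \<le> 0}"

definition feasible_set :: "'p mfd \<Rightarrow> ('p \<Rightarrow> 'q) \<Rightarrow> 'q set \<Rightarrow> 'p set" where
  "feasible_set M g K = {p \<in> topspace (mtop M). g p \<in> K}"

definition local_minimizer :: "'p mfd \<Rightarrow> ('p \<Rightarrow> real) \<Rightarrow> 'p set \<Rightarrow> 'p \<Rightarrow> bool" where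
  "local_minimizer M f F p \<longleftrightarrow>
     p \<in> F \<and> (\<exists>U. openin (mtop M) U \<and> p \<in> U \<and> (\<forall>q\<in>U \<inter> F. f p \<le> f q))"

definition ZKRCQ :: "'p mfd \<Rightarrow> 'q mfd \<Rightarrow> ('p \<Rightarrow> 'q) \<Rightarrow> nat \<Rightarrow> 'q set \<Rightarrow> 'p \<Rightarrow> bool" where
  "ZKRCQ M N g k K p \<longleftrightarrow>
     tvec_set_minus (tangent_map M N g p ` tangent_space M p) (inner_tangent N k K (g p))
       = tangent_space N (g p)"

definition LICQ :: "'p mfd \<Rightarrow> 'q mfd \<Rightarrow> ('p \<Rightarrow> 'q) \<Rightarrow> nat \<Rightarrow> 'q set \<Rightarrow> 'p \<Rightarrow> bool" where
  "LICQ M N g k K p \<longleftrightarrow>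
     tvec_set_minus (tangent_map M N g p ` tangent_space M p) (inner_tangent0 N k K (g p))
       = tangent_space N (g p)"

definition multipliers ::
  "'p mfd \<Rightarrow> 'q mfd \<Rightarrow> ('p \<Rightarrow> real) \<Rightarrow> ('p \<Rightarrow> 'q) \<Rightarrow> nat \<Rightarrow> 'q set \<Rightarrow> 'p \<Rightarrow> ('q tvec \<Rightarrow> real) set"
where
  "multipliers M N f g k K p =
     {\<mu> \<in> cotangent_space N (g p).
        (\<forall>v\<in>tangent_space M p. differential M f p v + \<mu> (tangent_map M N g p v) = 0) \<and>
        \<mu> \<in> polar_cone N (g p) (inner_tangent N k K (g p))}"

end

theory Submission
  imports Defs
begin

text \<open>
  In a chart of M and an adapted chart of N the problem is a finite-dimensional one with finitely many
  constraints, all active at the minimizer.  Penalizing their violation quadratically, and adding the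
  squared distance to the minimizer, gives unconstrained problems on a small ball whose solutions
  converge to the minimizer; the normalized limit of their stationarity conditions is the Fritz John
  condition, so neither an implicit function theorem nor Farkas' lemma is needed.
  A multiplier with vanishing objective weight would be nonnegative on
  image g' - T^i, which is everything under ZKRCQ, hence zero.

  Writing a tangent vector as y = g' v - s with s in T^i, any multiplier satisfies
  \<mu> y \<ge> - f' v, so the set of multipliers lies in a product of compact intervals, where it is closed.
  If s is in T^0, then \<mu> y = - f' v, which determines \<mu>.
\<close>

section \<open>The coordinate spaces\<close>

text \<open>The coordinate spaces sit inside an infinite-dimensional space. Derivatives within
  relatively open subsets of \<open>Rn n\<close> are unique only in directions of
  \<open>Rn n\<close>, and closed balls become compact only after intersection with
  \<open>Rn n\<close>. This is why directions carry membership in \<open>Rn n\<close> and why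
  derivatives are compared direction by direction.

  An inner tangent vector comes with an unknown adapted chart as witness, whereas the
  finite-dimensional problem lives in one fixed chart. The derivative of a chart transition
  therefore has to carry one corner cone into the other; this is checked one constraint functional
  at a time.

  The squared distance is added because the minimizer need not be strict: the penalized solutions
  could otherwise converge to a different minimizer.

  A vanishing form contradicts the normalization of the Fritz John multipliers only because the
  constraint rows are linearly independent. This is where the surjectivity of \<open>A\<close> on
  \<open>Rn k\<close> enters.\<close>

lemma subspace_Rn: "subspace (Rn n)"
  by (auto simp: subspace_def Rn_def)

lemma Rn_mono: "k \<le> n \<Longrightarrow> Rn k \<subseteq> Rn n"
  by (auto simp: Rn_def)

lemma bounded_linear_coord: "bounded_linear (\<lambda>x::rseq. apply_bcontfun x i)"
  by (rule bounded_linear_intro[where K=1]) (use norm_bounded[where 'b=real] in auto)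

lemmas tendsto_coord [tendsto_intros] = bounded_linear.tendsto[OF bounded_linear_coord]
  and continuous_on_coord [continuous_intros] = bounded_linear.continuous_on[OF bounded_linear_coord]
  and has_derivative_coord [derivative_intros] = bounded_linear.has_derivative[OF bounded_linear_coord]

lemma coord_sum: "apply_bcontfun (\<Sum>i\<in>I. f i) j = (\<Sum>i\<in>I. apply_bcontfun (f i :: rseq) j)"
  by (rule linear_sum) (simp add: bounded_linear.linear bounded_linear_coord)

definition unit_seq :: "nat \<Rightarrow> rseq" where
  "unit_seq i = Bcontfun (\<lambda>j. of_bool (j = i))"

lemma coord_unit_seq [simp]: "apply_bcontfun (unit_seq i) j = of_bool (j = i)"
proof -
  have "(\<lambda>j. of_bool (j = i) :: real) \<in> bcontfun"
    by (rule bcontfun_normI[where b=1]) auto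
  then show ?thesis
    by (simp add: unit_seq_def Bcontfun_inverse)
qed

lemma unit_seq_in_Rn [simp]: "unit_seq i \<in> Rn n \<longleftrightarrow> i < n"
  by (simp add: Rn_def) (metis linorder_not_le)

lemma sum_unit_seq_in_Rn: "(\<Sum>i<n. a i *\<^sub>R unit_seq i) \<in> Rn n"
  by (intro subspace_sum subspace_scale subspace_Rn) simp

lemma Rn_expansion: "x \<in> Rn n \<Longrightarrow> x = (\<Sum>i<n. apply_bcontfun x i *\<^sub>R unit_seq i)"
  by (rule bcontfun_eqI) (auto simp: coord_sum Rn_def of_bool_def if_distrib cong: if_cong)

lemma Rn_eqI:
  assumes "x \<in> Rn n" "y \<in> Rn n" "\<And>i. i < n \<Longrightarrow> apply_bcontfun x i = apply_bcontfun y i"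
  shows "x = y"
proof (rule bcontfun_eqI)
  show "apply_bcontfun x i = apply_bcontfun y i" for i
    using assms by (cases "i < n") (simp_all add: Rn_def)
qed

lemma linear_on_Rn:
  assumes "linear L" "x \<in> Rn n"
  shows "L x = (\<Sum>i<n. apply_bcontfun x i *\<^sub>R L (unit_seq i))"
  by (subst Rn_expansion[OF assms(2)]) (simp add: linear_sum[OF assms(1)] linear_scale[OF assms(1)])

text \<open>With finitely many indices, successive extraction replaces a diagonal argument. It
  serves both the coordinates of points in a ball and the normalized multipliers.\<close>

lemma bounded_family_convergent_subsequence:
  fixes a :: "nat \<Rightarrow> 'i \<Rightarrow> 'b::heine_borel"
  assumes "finite I" "\<And>i. i \<in> I \<Longrightarrow> bounded (range (\<lambda>j. a j i))"
  shows "\<exists>l r. strict_mono (r :: nat \<Rightarrow> nat) \<and> (\<forall>i\<in>I. (\<lambda>j. a (r j) i) \<longlonglongrightarrow> l i)"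
  using assms
proof (induction I rule: finite_induct)
  case empty
  show ?case
    by (auto intro: strict_mono_id[unfolded id_def])
next
  case (insert k I)
  then obtain l r where r: "strict_mono (r :: nat \<Rightarrow> nat)" "\<And>i. i \<in> I \<Longrightarrow> (\<lambda>j. a (r j) i) \<longlonglongrightarrow> l i"
    by auto
  have "bounded (range (\<lambda>j. a (r j) k))"
    by (rule bounded_subset[OF insert.prems[of k]]) auto
  then obtain y s where s: "strict_mono (s :: nat \<Rightarrow> nat)" "(\<lambda>j. a (r (s j)) k) \<longlonglongrightarrow> y"
    using bounded_imp_convergent_subsequence[of "\<lambda>j. a (r j) k"] by (auto simp: o_def)
  have "(\<lambda>j. a ((r \<circ> s) j) i) \<longlonglongrightarrow> (l(k := y)) i" if "i \<in> insert k I" for i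
    using that s(2) insert.hyps LIMSEQ_subseq_LIMSEQ[OF r(2) s(1), of i]
    by (auto simp: o_def)
  moreover have "strict_mono (r \<circ> s)"
    using r s by (simp add: strict_mono_o)
  ultimately show ?case
    by blast
qed

text \<open>Convergence of the first \<open>n\<close> coordinates is norm convergence on
  \<open>Rn n\<close>, since a point is a fixed finite combination of unit sequences with its
  coordinates as coefficients.\<close>

lemma compact_Rn_cball: "compact (Rn n \<inter> cball x r)"
  unfolding compact_def
proof (intro allI impI)
  fix f :: "nat \<Rightarrow> rseq" assume f: "\<forall>j. f j \<in> Rn n \<inter> cball x r"
  have "bounded (range (\<lambda>j. apply_bcontfun (f j) i))" for i
  proof (rule bounded_subset)
    show "bounded ((\<lambda>y. apply_bcontfun y i) ` cball x r)"
      by (intro bounded_linear_image bounded_linear_coord bounded_cball)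
  qed (use f in auto)
  then obtain l s where s: "strict_mono (s :: nat \<Rightarrow> nat)"
    "\<And>i. i < n \<Longrightarrow> (\<lambda>j. apply_bcontfun (f (s j)) i) \<longlonglongrightarrow> l i"
    using bounded_family_convergent_subsequence[of "{..<n}" "\<lambda>j. apply_bcontfun (f j)"] by auto
  define y where "y = (\<Sum>i<n. l i *\<^sub>R unit_seq i)"
  have "(\<lambda>j. \<Sum>i<n. apply_bcontfun (f (s j)) i *\<^sub>R unit_seq i) \<longlonglongrightarrow> y"
    unfolding y_def by (intro tendsto_intros s) auto
  moreover have "(\<Sum>i<n. apply_bcontfun (f (s j)) i *\<^sub>R unit_seq i) = f (s j)" for j
    using f by (intro Rn_expansion[symmetric]) auto
  ultimately have lim: "(f \<circ> s) \<longlonglongrightarrow> y"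
    by (simp add: o_def)
  moreover have "y \<in> cball x r"
    by (rule closed_sequentially[OF closed_cball _ lim]) (use f in auto)
  ultimately show "\<exists>l\<in>Rn n \<inter> cball x r. \<exists>r. strict_mono r \<and> (f \<circ> r) \<longlonglongrightarrow> l"
    using s(1) sum_unit_seq_in_Rn[of l n] by (auto simp: y_def)
qed

text \<open>Fermat's rule. Restriction to the line through \<open>x\<close> in direction
  \<open>v\<close> gives a function of one real variable with an open domain, where the derivative
  is an ordinary one.\<close>

lemma derivative_vanishes_at_minimum_on_Rn:
  fixes F :: "rseq \<Rightarrow> real"
  assumes S: "openin (top_of_set (Rn n)) S" and x: "x \<in> S" and v: "v \<in> Rn n"
    and D: "(F has_derivative D) (at x within S)" and min: "\<And>y. y \<in> S \<Longrightarrow> F x \<le> F y"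
  shows "D v = 0"
proof -
  obtain T where T: "open T" "S = Rn n \<inter> T"
    using S by (auto simp: openin_open)
  define line where "line = (\<lambda>t::real. x + t *\<^sub>R v)"
  have o: "open (line -` T)"
    unfolding line_def by (intro open_vimage T continuous_intros)
  have 0: "0 \<in> line -` T"
    using x T by (simp add: line_def)
  have img: "line ` (line -` T) \<subseteq> S"
    using x v T by (auto simp: line_def Rn_def)
  have "(line has_derivative (\<lambda>t. t *\<^sub>R v)) (at 0 within line -` T)"
    unfolding line_def by (auto intro!: derivative_eq_intros)
  moreover have "(F has_derivative D) (at (line 0) within line ` (line -` T))"
    using has_derivative_subset[OF D img] by (simp add: line_def)
  ultimately have "((\<lambda>t. F (line t)) has_derivative (\<lambda>t. D (t *\<^sub>R v))) (at 0 within line -` T)"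
    by (rule has_derivative_in_compose)
  then have "((\<lambda>t. F (line t)) has_derivative (\<lambda>t. D (t *\<^sub>R v))) (at 0)"
    using o 0 by (metis at_within_open)
  moreover have "\<forall>t\<in>line -` T. F (line 0) \<le> F (line t)"
    using min img by (auto simp: line_def)
  ultimately have "(\<lambda>t. D (t *\<^sub>R v)) = (\<lambda>t. 0)"
    using differential_zero_maxmin[of 0 "line -` T" "\<lambda>t. F (line t)"] o 0 by blast
  then show ?thesis
    by (metis scaleR_one)
qed

section \<open>A Fritz John theorem\<close>

text \<open>Squaring removes the kink of the positive part at 0.\<close>

lemma has_real_derivative_square_pos_part:
  "((\<lambda>t::real. (max 0 t)\<^sup>2) has_real_derivative 2 * max 0 x) (at x)"
proof -
  \<comment> \<open>The remainder is at most the square of the increment. When the sign changes,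
    \<open>x * y \<le> 0\<close> makes that square large enough.\<close>
  have *: "\<bar>(max 0 y)\<^sup>2 - (max 0 x)\<^sup>2 - (y - x) * (2 * max 0 x)\<bar> \<le> (y - x)\<^sup>2" for y :: real
  proof -
    consider "0 \<le> x" "0 \<le> y" | "x \<le> 0" "y \<le> 0" | "0 \<le> x" "y \<le> 0" | "x \<le> 0" "0 \<le> y"
      by linarith
    then show ?thesis
    proof cases
      case 1
      then have "(max 0 y)\<^sup>2 - (max 0 x)\<^sup>2 - (y - x) * (2 * max 0 x) = (y - x)\<^sup>2"
        by (simp add: power2_eq_square algebra_simps)
      then show ?thesis
        by simp
    next
      case 2
      then show ?thesis
        by (simp add: max_absorb1)
    next
      case 3
      then have "x * y \<le> 0"
        by (simp add: mult_nonneg_nonpos)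
      moreover have "0 \<le> x\<^sup>2 - 2 * (x * y)"
        using zero_le_power2[of x] \<open>x * y \<le> 0\<close> by linarith
      ultimately show ?thesis
        using 3 by (simp add: max_def power2_eq_square algebra_simps)
    next
      case 4
      then have "x * y \<le> 0"
        by (simp add: mult_nonpos_nonneg)
      then show ?thesis
        using 4 zero_le_square[of x] by (simp add: max_def power2_eq_square algebra_simps)
    qed
  qed
  have "((\<lambda>y. ((max 0 y)\<^sup>2 - (max 0 x)\<^sup>2 - (y - x) * (2 * max 0 x)) / norm (y - x)) \<longlongrightarrow> 0) (at x)"
  proof (rule Lim_null_comparison)
    show "\<forall>\<^sub>F y in at x. norm (((max 0 y)\<^sup>2 - (max 0 x)\<^sup>2 - (y - x) * (2 * max 0 x)) / norm (y - x))
        \<le> \<bar>y - x\<bar>"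
      using * by (auto simp: divide_le_eq power2_eq_square eventually_at_filter)
    show "((\<lambda>y. \<bar>y - x\<bar>) \<longlongrightarrow> 0) (at x)"
      by (rule tendsto_eq_intros tendsto_ident_at)+ auto
  qed
  then show ?thesis
    by (auto simp: has_field_derivative_def has_derivative_def mult.commute diff_diff_eq divide_inverse_commute
        intro!: bounded_linear_intros)
qed

text \<open>\<open>E\<close> marks the equality constraints, whose multipliers have no sign. All
  constraints are active at \<open>x0\<close>, so no complementarity condition appears. The sum
  normalized to 1 excludes the trivial multiplier.\<close>

lemma fritz_john_on_Rn:
  fixes F :: "rseq \<Rightarrow> real" and h :: "'i \<Rightarrow> rseq \<Rightarrow> real"
  assumes S: "openin (top_of_set (Rn m)) S" and x0: "x0 \<in> S" and I: "finite I"
    and F': "\<And>x. x \<in> S \<Longrightarrow> (F has_derivative F' x) (at x within S)"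
    and F'_cont: "\<And>v. v \<in> Rn m \<Longrightarrow> continuous_on S (\<lambda>x. F' x v)"
    and h': "\<And>i x. i \<in> I \<Longrightarrow> x \<in> S \<Longrightarrow> (h i has_derivative h' i x) (at x within S)"
    and h'_cont: "\<And>i v. i \<in> I \<Longrightarrow> v \<in> Rn m \<Longrightarrow> continuous_on S (\<lambda>x. h' i x v)"
    and h0: "\<And>i. i \<in> I \<Longrightarrow> h i x0 = 0"
    and min: "\<And>x. x \<in> S \<Longrightarrow> \<forall>i\<in>I. if i \<in> E then h i x = 0 else h i x \<le> 0 \<Longrightarrow> F x0 \<le> F x"
  obtains a b where "0 \<le> a" "\<And>i. i \<in> I - E \<Longrightarrow> 0 \<le> b i" "a + (\<Sum>i\<in>I. \<bar>b i\<bar>) = 1"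
    "\<And>v. v \<in> Rn m \<Longrightarrow> a * F' x0 v + (\<Sum>i\<in>I. b i * h' i x0 v) = 0"
proof -
  obtain r where r: "0 < r" "cball x0 r \<inter> Rn m \<subseteq> S" and SR: "S \<subseteq> Rn m"
    using S x0 unfolding openin_contains_cball by blast
  define B where "B = Rn m \<inter> cball x0 r"
  have B: "compact B" "B \<subseteq> S" "x0 \<in> B"
    using r x0 SR by (auto simp: B_def compact_Rn_cball)
  \<comment> \<open>Stationarity needs differentiable penalties, hence squares. The derivative
    \<open>pen'\<close> is nonnegative off \<open>E\<close>, which is the origin of the sign of the
    multipliers.\<close>
  define pen where "pen i t = (if i \<in> E then t\<^sup>2 else (max 0 t)\<^sup>2)" for i and t :: real
  define pen' where "pen' i t = (if i \<in> E then 2 * t else 2 * max 0 t)" for i and t :: real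
  have pen': "(pen i has_real_derivative pen' i t) (at t)" for i t
    using has_real_derivative_square_pos_part[of t]
    by (cases "i \<in> E") (auto simp: pen_def[abs_def] pen'_def intro!: derivative_eq_intros)
  have pen_nonneg: "0 \<le> pen i t" for i t
    by (simp add: pen_def)
  \<comment> \<open>The sup norm is not differentiable, so the distance is the Euclidean one in the
    first \<open>m\<close> coordinates; on \<open>Rn m\<close> it vanishes at \<open>x0\<close>
    only.\<close>
  define q where "q x = (\<Sum>i<m. (apply_bcontfun x i - apply_bcontfun x0 i)\<^sup>2)" for x :: rseq
  define P where "P x = (\<Sum>i\<in>I. pen i (h i x))" for x
  define \<phi> where "\<phi> j x = F x + q x + real j * P x" for j x
  define \<phi>' where "\<phi>' j x v = F' x v
      + (\<Sum>i<m. 2 * (apply_bcontfun x i - apply_bcontfun x0 i) * apply_bcontfun v i)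
      + real j * (\<Sum>i\<in>I. pen' i (h i x) * h' i x v)" for j x v
  have pen_h: "((\<lambda>x. pen i (h i x)) has_derivative (\<lambda>v. pen' i (h i x) * h' i x v)) (at x within S)"
    if "i \<in> I" "x \<in> S" for i x
    using has_derivative_compose[OF h'[OF that], of "pen i" "(*) (pen' i (h i x))"]
      pen'[of i "h i x"] by (simp add: has_field_derivative_def)
  have \<phi>': "(\<phi> j has_derivative \<phi>' j x) (at x within S)" if "x \<in> S" for j x
    unfolding \<phi>_def[abs_def] \<phi>'_def[abs_def] q_def P_def
    by (rule derivative_eq_intros refl F' pen_h that | assumption)+ (simp add: mult_ac)
  have F_cont: "continuous_on S F"
    using F' has_derivative_continuous continuous_on_eq_continuous_within by blast
  have P_cont: "continuous_on S P"
    unfolding P_def using pen_h has_derivative_continuous continuous_on_eq_continuous_within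
    by (intro continuous_on_sum) blast
  have q_cont: "continuous_on S q"
    unfolding q_def by (intro continuous_intros)
  have P_nonneg: "0 \<le> P x" for x
    unfolding P_def by (intro sum_nonneg pen_nonneg)
  have q_nonneg: "0 \<le> q x" for x
    unfolding q_def by (intro sum_nonneg) auto
  have P0: "P x0 = 0"
    unfolding P_def by (intro sum.neutral) (auto simp: pen_def h0)
  have "continuous_on S (\<phi> j)" for j
    using \<phi>' has_derivative_continuous continuous_on_eq_continuous_within by blast
  then have "\<exists>x\<in>B. \<forall>y\<in>B. \<phi> j x \<le> \<phi> j y" for j
    using B by (intro continuous_attains_inf) (auto intro: continuous_on_subset)
  then obtain X where X: "\<And>j. X j \<in> B" "\<And>j y. y \<in> B \<Longrightarrow> \<phi> j (X j) \<le> \<phi> j y"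
    by metis
  \<comment> \<open>Comparison with \<open>x0\<close>, where both added terms vanish. This one
    inequality yields the feasibility of the limit as well as its position.\<close>
  have X_le: "F (X j) + q (X j) + real j * P (X j) \<le> F x0" for j
    using X(2)[OF B(3), of j] P0 by (simp add: \<phi>_def q_def)
  obtain \<xi> \<rho> where \<xi>: "\<xi> \<in> B" and \<rho>: "strict_mono (\<rho> :: nat \<Rightarrow> nat)" and lim: "(\<lambda>j. X (\<rho> j)) \<longlonglongrightarrow> \<xi>"
    using B(1) X(1) unfolding compact_def o_def by blast
  have lim_comp: "(\<lambda>j. G (X (\<rho> j))) \<longlonglongrightarrow> G \<xi>" if "continuous_on S G" for G :: "rseq \<Rightarrow> real"
    by (rule continuous_on_tendsto_compose[OF that lim])
      (use X(1) B(2) \<xi> in \<open>blast intro: always_eventually\<close>)+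
  \<comment> \<open>A lower bound of \<open>F\<close> on \<open>B\<close> turns \<open>X_le\<close>
    into decay of \<open>P\<close> along the minimizers, at rate 1/j.\<close>
  obtain z where z: "\<And>y. y \<in> B \<Longrightarrow> F z \<le> F y"
    using continuous_attains_inf[OF B(1) _ continuous_on_subset[OF F_cont B(2)]] B(3) by blast
  have "P \<xi> \<le> 0"
  proof (rule tendsto_le)
    show "(\<lambda>j. (F x0 - F z) / real j) \<longlonglongrightarrow> 0"
      by (rule lim_const_over_n)
    show "(\<lambda>j. P (X (\<rho> j))) \<longlonglongrightarrow> P \<xi>"
      by (rule lim_comp[OF P_cont])
    show "\<forall>\<^sub>F j in sequentially. P (X (\<rho> j)) \<le> (F x0 - F z) / real j"
      using eventually_gt_at_top[of "0::nat"]
    proof eventually_elim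
      case (elim j)
      have "real j * P (X (\<rho> j)) \<le> real (\<rho> j) * P (X (\<rho> j))"
        using seq_suble[OF \<rho>, of j] by (simp add: mult_right_mono P_nonneg)
      also have "\<dots> \<le> F x0 - F z"
        using X_le[of "\<rho> j"] q_nonneg[of "X (\<rho> j)"] z[OF X(1), of "\<rho> j"] by linarith
      finally show ?case
        using elim by (simp add: field_simps)
    qed
  qed simp
  then have "P \<xi> = 0"
    using P_nonneg[of \<xi>] by linarith
  then have "pen i (h i \<xi>) = 0" if "i \<in> I" for i
    using that I pen_nonneg by (simp add: P_def sum_nonneg_eq_0_iff)
  then have "\<forall>i\<in>I. if i \<in> E then h i \<xi> = 0 else h i \<xi> \<le> 0"
    by (fastforce simp: pen_def max_def split: if_splits)
  then have "F x0 \<le> F \<xi>"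
    using min \<xi> B(2) by blast
  moreover have "F \<xi> + q \<xi> \<le> F x0"
  proof (rule tendsto_le[OF _ tendsto_const])
    show "(\<lambda>j. F (X (\<rho> j)) + q (X (\<rho> j))) \<longlonglongrightarrow> F \<xi> + q \<xi>"
      by (intro tendsto_intros lim_comp F_cont q_cont)
    have "F (X j) + q (X j) \<le> F x0" for j
      using X_le[of j] mult_nonneg_nonneg[OF of_nat_0_le_iff P_nonneg, of j "X j"] by linarith
    then show "\<forall>\<^sub>F j in sequentially. F (X (\<rho> j)) + q (X (\<rho> j)) \<le> F x0"
      by simp
  qed simp
  \<comment> \<open>The limit is feasible, so its value is at least \<open>F x0\<close>; the limit
    of \<open>X_le\<close> leaves no room for a positive \<open>q\<close>.\<close>
  ultimately have "q \<xi> = 0"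
    using q_nonneg[of \<xi>] by linarith
  then have "\<forall>i<m. apply_bcontfun \<xi> i = apply_bcontfun x0 i"
    by (simp add: q_def sum_nonneg_eq_0_iff)
  moreover have "\<xi> \<in> Rn m" "x0 \<in> Rn m"
    using \<xi> x0 SR by (auto simp: B_def)
  ultimately have "\<xi> = x0"
    by (intro Rn_eqI[of \<xi> m x0]) auto
  \<comment> \<open>These are the constraint coefficients in the stationarity condition of
    \<open>\<phi> j\<close>, and they may be unbounded in \<open>j\<close>. The 1 in
    \<open>s\<close> is the coefficient of \<open>F\<close>, so division by \<open>s\<close> makes
    the absolute values of all coefficients, that of \<open>F\<close> included, sum to 1.\<close>
  define c where "c j i = real j * pen' i (h i (X j))" for j i
  define s where "s j = 1 + (\<Sum>i\<in>I. \<bar>c j i\<bar>)" for j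
  define b where "b j i = c j i / s j" for j i
  have s: "1 \<le> s j" "(\<Sum>i\<in>I. \<bar>c j i\<bar>) = s j - 1" for j
    by (auto simp: s_def intro!: sum_nonneg)
  have b_sum: "1 - (\<Sum>i\<in>I. \<bar>b j i\<bar>) = 1 / s j" for j
  proof -
    have "(\<Sum>i\<in>I. \<bar>b j i\<bar>) = (s j - 1) / s j"
      using s[of j] by (simp add: b_def abs_divide flip: sum_divide_distrib)
    then show ?thesis
      using s(1)[of j] by (simp add: field_simps)
  qed
  have b_le: "\<bar>b j i\<bar> \<le> 1" if "i \<in> I" for j i
  proof -
    have "\<bar>b j i\<bar> \<le> (\<Sum>i\<in>I. \<bar>b j i\<bar>)"
      using that I by (intro member_le_sum) auto
    then show ?thesis
      using b_sum[of j] s(1)[of j] by (smt (verit) divide_nonneg_nonneg)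
  qed
  have b_nonneg: "0 \<le> b j i" if "i \<in> I - E" for j i
    using that s(1)[of j] by (auto simp: b_def c_def pen'_def)
  have "bounded (range (\<lambda>j. b (\<rho> j) i))" if "i \<in> I" for i
    using b_le[OF that] by (intro boundedI[where B=1]) auto
  then obtain \<beta> \<sigma> where \<sigma>: "strict_mono (\<sigma> :: nat \<Rightarrow> nat)"
    and \<beta>: "\<And>i. i \<in> I \<Longrightarrow> (\<lambda>j. b (\<rho> (\<sigma> j)) i) \<longlonglongrightarrow> \<beta> i"
    using bounded_family_convergent_subsequence[OF I, of "\<lambda>j. b (\<rho> j)"] by blast
  define Y where "Y j = X (\<rho> (\<sigma> j))" for j
  have Y_lim: "Y \<longlonglongrightarrow> x0"
    using LIMSEQ_subseq_LIMSEQ[OF lim \<sigma>] by (simp add: Y_def[abs_def] o_def \<open>\<xi> = x0\<close>)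
  have Y_in: "Y j \<in> S" for j
    using X(1) B(2) by (auto simp: Y_def)
  have lim_comp': "(\<lambda>j. G (Y j)) \<longlonglongrightarrow> G x0" if "continuous_on S G" for G :: "rseq \<Rightarrow> real"
    by (rule continuous_on_tendsto_compose[OF that Y_lim x0]) (simp add: Y_in)
  define Q where "Q x v = (\<Sum>i<m. 2 * (apply_bcontfun x i - apply_bcontfun x0 i) * apply_bcontfun v i)"
    for x v :: rseq
  define \<alpha> where "\<alpha> = 1 - (\<Sum>i\<in>I. \<bar>\<beta> i\<bar>)"
  have \<alpha>: "(\<lambda>j. 1 / s (\<rho> (\<sigma> j))) \<longlonglongrightarrow> \<alpha>"
    unfolding b_sum[symmetric] \<alpha>_def by (intro tendsto_intros \<beta>)
  have near: "\<forall>\<^sub>F j in sequentially. dist (Y j) x0 < r"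
    using Y_lim r(1) by (rule tendstoD)
  have stationary: "1 / s j * (F' (X j) v + Q (X j) v) + (\<Sum>i\<in>I. b j i * h' i (X j) v) = 0"
    if j: "dist (X j) x0 < r" and v: "v \<in> Rn m" for j v
  proof -
    \<comment> \<open>Fermat's rule needs a relatively open domain. \<open>X j\<close> minimizes
      over the closed ball, and it lies in the open one from some index of the subsequence
      on.\<close>
    define B0 where "B0 = Rn m \<inter> ball x0 r"
    have B0: "B0 \<subseteq> B" "X j \<in> B0"
      using X(1)[of j] j by (auto simp: B0_def B_def dist_commute)
    have "\<phi>' j (X j) v = 0"
    proof (rule derivative_vanishes_at_minimum_on_Rn[of m B0 "X j"])
      show "openin (top_of_set (Rn m)) B0"
        unfolding B0_def by (intro openin_open_Int open_ball)
      show "(\<phi> j has_derivative \<phi>' j (X j)) (at (X j) within B0)"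
        using B0 B(2) by (intro has_derivative_subset[OF \<phi>', of _ B0]) auto
    qed (use B0 X(2) v in auto)
    then have "F' (X j) v + Q (X j) v + (\<Sum>i\<in>I. c j i * h' i (X j) v) = 0"
      by (simp add: \<phi>'_def Q_def c_def sum_distrib_left mult_ac)
    then have "(F' (X j) v + Q (X j) v + (\<Sum>i\<in>I. c j i * h' i (X j) v)) / s j = 0"
      by simp
    then show ?thesis
      by (simp add: b_def add_divide_distrib sum_divide_distrib)
  qed
  show thesis
  proof (rule that[of \<alpha> \<beta>])
    show "0 \<le> \<alpha>"
      by (rule tendsto_lowerbound[OF \<alpha>]) (auto simp: order_trans[OF zero_le_one s(1)])
    show "0 \<le> \<beta> i" if "i \<in> I - E" for i
      using that by (intro tendsto_lowerbound[OF \<beta>]) (auto simp: b_nonneg)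
    show "\<alpha> + (\<Sum>i\<in>I. \<bar>\<beta> i\<bar>) = 1"
      by (simp add: \<alpha>_def)
    fix v assume v: "v \<in> Rn m"
    have Q_lim: "(\<lambda>j. Q (Y j) v) \<longlonglongrightarrow> Q x0 v"
      unfolding Q_def by (intro lim_comp' continuous_intros)
    let ?lhs = "\<lambda>j. 1 / s (\<rho> (\<sigma> j)) * (F' (Y j) v + Q (Y j) v) + (\<Sum>i\<in>I. b (\<rho> (\<sigma> j)) i * h' i (Y j) v)"
    have "?lhs \<longlonglongrightarrow> \<alpha> * (F' x0 v + Q x0 v) + (\<Sum>i\<in>I. \<beta> i * h' i x0 v)"
      by (intro tendsto_intros \<alpha> \<beta> Q_lim lim_comp' F'_cont h'_cont v)
    moreover have "\<forall>\<^sub>F j in sequentially. ?lhs j = 0"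
      using near by eventually_elim (use stationary v in \<open>auto simp: Y_def\<close>)
    ultimately have "\<alpha> * (F' x0 v + Q x0 v) + (\<Sum>i\<in>I. \<beta> i * h' i x0 v) = 0"
      by (rule LIMSEQ_unique[OF _ tendsto_eventually])
    \<comment> \<open>The squared distance is critical at its center, so \<open>Q x0\<close> is zero
      and the auxiliary term leaves no trace in the limit.\<close>
    then show "\<alpha> * F' x0 v + (\<Sum>i\<in>I. \<beta> i * h' i x0 v) = 0"
      by (simp add: Q_def)
  qed
qed

section \<open>Differentials in charts\<close>

text \<open>The derivatives of \<open>L\<close> and \<open>H\<close> are taken within different
  sets. Both restrict to the relatively open intersection, where uniqueness in directions of
  \<open>Rn m\<close> identifies them with the composed derivative. It gives the chain rule for
  chart representations and the chart independence of the differential.\<close>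

lemma chain_on_Rn:
  fixes L :: "rseq \<Rightarrow> rseq" and F :: "rseq \<Rightarrow> 'a::real_normed_vector"
  assumes S1: "openin (top_of_set (Rn m)) S1" and S3: "openin (top_of_set (Rn m)) S3"
    and x: "x \<in> S1" "x \<in> S3" and v: "v \<in> Rn m"
    and L: "(L has_derivative D1) (at x within S1)"
    and F: "(F has_derivative D2) (at (L x) within S2)"
    and H: "(H has_derivative D3) (at x within S3)"
    and eq: "\<And>y. y \<in> S1 \<Longrightarrow> y \<in> S3 \<Longrightarrow> L y \<in> S2 \<and> H y = F (L y)"
  shows "D3 v = D2 (D1 v)"
proof -
  let ?S = "S1 \<inter> S3"
  have L': "(L has_derivative D1) (at x within ?S)"
    by (rule has_derivative_subset[OF L]) simp
  have H': "(H has_derivative D3) (at x within ?S)"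
    by (rule has_derivative_subset[OF H]) simp
  have "L ` ?S \<subseteq> S2"
    using eq by blast
  then have "((\<lambda>y. F (L y)) has_derivative (\<lambda>v. D2 (D1 v))) (at x within ?S)"
    using has_derivative_in_compose[OF L' has_derivative_subset[OF F]] by blast
  then have "(H has_derivative (\<lambda>v. D2 (D1 v))) (at x within ?S)"
    by (rule has_derivative_transform[rotated 2]) (use x eq in auto)
  then show ?thesis
    using H' by (rule_tac has_derivative_within_unique_on_Rn[OF openin_Int[OF S1 S3] _ v]) (use x in auto)
qed

lemma Ck_on_2E:
  assumes "Ck_on 2 n S F"
  obtains F' where "\<And>x. x \<in> S \<Longrightarrow> (F has_derivative F' x) (at x within S)"
    "\<And>v. v \<in> Rn n \<Longrightarrow> continuous_on S (\<lambda>x. F' x v)"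
proof -
  obtain F' where F': "\<And>x. x \<in> S \<Longrightarrow> (F has_derivative F' x) (at x within S)"
    "\<And>v. v \<in> Rn n \<Longrightarrow> Ck_on (Suc 0) n S (\<lambda>x. F' x v)"
    using assms unfolding numeral_2_eq_2 Ck_on.simps(2)[of "Suc 0"] by blast
  have "continuous_on S (\<lambda>x. F' x v)" if v: "v \<in> Rn n" for v
    using F'(2)[OF v] has_derivative_continuous continuous_on_eq_continuous_within
    unfolding Ck_on.simps by blast
  with F' show thesis
    using that by blast
qed

lemma has_frechet_derivative_Ck_on_2:
  assumes "Ck_on 2 n S F" "x \<in> S"
  shows "(F has_derivative frechet_derivative F (at x within S)) (at x within S)"
  using assms by (metis Ck_on_2E differentiableI frechet_derivative_works)

section \<open>Charts as homeomorphisms onto relatively open sets, and maps expressed in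
  charts\<close>

lemma top_chart_inj_on: "top_chart n X c \<Longrightarrow> inj_on (snd c) (fst c)"
  unfolding top_chart_def
  by (metis homeomorphic_imp_injective_map openin_subset topspace_subtopology_subset)

lemma in_chart_apply: "top_chart n X c \<Longrightarrow> u \<in> fst c \<Longrightarrow> in_chart c h (snd c u) = h u"
  by (simp add: inv_into_f_f top_chart_inj_on)

lemma top_chart_openin_image:
  assumes "top_chart n X c" "openin X V" "V \<subseteq> fst c"
  shows "openin (top_of_set (Rn n)) (snd c ` V)"
proof -
  have "openin (subtopology X (fst c)) V"
    using assms by (metis openin_open_subtopology top_chart_def)
  then have "openin (top_of_set (snd c ` fst c)) (snd c ` V)"
    using assms homeomorphic_imp_open_map unfolding top_chart_def open_map_def by blast
  then show ?thesis
    using assms(1) openin_trans unfolding top_chart_def by blast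
qed

lemma top_chart_in_Rn: "top_chart n X c \<Longrightarrow> u \<in> fst c \<Longrightarrow> snd c u \<in> Rn n"
  unfolding top_chart_def using openin_imp_subset by blast

lemma charts_atD:
  assumes "C2_manifold M" "c \<in> charts_at M p"
  shows "top_chart (mdim M) (mtop M) c" "p \<in> fst c" "c \<in> atlas M" "openin (mtop M) (fst c)"
  using assms by (auto simp: C2_manifold_def charts_at_def top_chart_def)

lemma charts_at_nonempty: "C2_manifold M \<Longrightarrow> p \<in> topspace (mtop M) \<Longrightarrow> \<exists>c. c \<in> charts_at M p"
  unfolding C2_manifold_def charts_at_def by blast

text \<open>For \<open>g = id\<close> this is the derivative of a chart transition, as in
  \<open>tangent_space\<close>. One composition rule thus covers the transition law and the
  naturality of the tangent map.\<close>

definition chart_diff :: "'p chart \<Rightarrow> 'q chart \<Rightarrow> ('p \<Rightarrow> 'q) \<Rightarrow> 'p \<Rightarrow> rseq \<Rightarrow> rseq" where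
  "chart_diff c d g p = frechet_derivative (in_chart c (snd d \<circ> g))
     (at (snd c p) within snd c ` (fst c \<inter> g -` fst d))"

lemma openin_chart_domain:
  assumes "C2_manifold M" "C2_manifold N" "C2_map M N g"
    and "c \<in> charts_at M p" "d \<in> charts_at N q"
  shows "openin (mtop M) (fst c \<inter> g -` fst d)"
proof -
  have "openin (mtop M) {x \<in> topspace (mtop M). g x \<in> fst d}"
    using assms charts_atD(4)[OF assms(2,5)] openin_continuous_map_preimage
    unfolding C2_map_def by blast
  moreover have "fst c \<inter> g -` fst d = fst c \<inter> {x \<in> topspace (mtop M). g x \<in> fst d}"
    using openin_subset[OF charts_atD(4)[OF assms(1,4)]] by auto
  ultimately show ?thesis
    using charts_atD(4)[OF assms(1,4)] by (simp add: openin_Int)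
qed

lemma openin_chart_domain_image:
  assumes "C2_manifold M" "C2_manifold N" "C2_map M N g"
    and "c \<in> charts_at M p" "d \<in> charts_at N q"
  shows "openin (top_of_set (Rn (mdim M))) (snd c ` (fst c \<inter> g -` fst d))"
  using openin_chart_domain[OF assms] charts_atD(1)[OF assms(1,4)]
  by (intro top_chart_openin_image) auto

lemma has_derivative_chart_diff:
  assumes "C2_manifold M" "C2_manifold N" "C2_map M N g"
    and "c \<in> charts_at M p" "d \<in> charts_at N (g p)"
  shows "(in_chart c (snd d \<circ> g) has_derivative chart_diff c d g p)
     (at (snd c p) within snd c ` (fst c \<inter> g -` fst d))"
  unfolding chart_diff_def
proof (rule has_frechet_derivative_Ck_on_2)
  show "Ck_on 2 (mdim M) (snd c ` (fst c \<inter> g -` fst d)) (in_chart c (snd d \<circ> g))"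
    using assms(3) charts_atD(3)[OF assms(1,4)] charts_atD(3)[OF assms(2,5)] by (simp add: C2_map_def)
qed (use charts_atD(2)[OF assms(1,4)] charts_atD(2)[OF assms(2,5)] in simp)

lemma linear_chart_diff:
  assumes "C2_manifold M" "C2_manifold N" "C2_map M N g"
    and "c \<in> charts_at M p" "d \<in> charts_at N (g p)"
  shows "linear (chart_diff c d g p)"
  using has_derivative_chart_diff[OF assms] has_derivative_linear by blast

text \<open>Each coordinate from \<open>mdim N\<close> on is identically zero on the relatively open
  domain, so its derivative is zero in the directions where it is determined.\<close>

lemma chart_diff_in_Rn:
  assumes "C2_manifold M" "C2_manifold N" "C2_map M N g"
    and "c \<in> charts_at M p" "d \<in> charts_at N (g p)" and v: "v \<in> Rn (mdim M)"
  shows "chart_diff c d g p v \<in> Rn (mdim N)"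
  unfolding Rn_def
proof (intro CollectI allI impI)
  fix i assume i: "mdim N \<le> i"
  let ?S = "snd c ` (fst c \<inter> g -` fst d)"
  have 1: "((\<lambda>x. apply_bcontfun (in_chart c (snd d \<circ> g) x) i) has_derivative
      (\<lambda>v. apply_bcontfun (chart_diff c d g p v) i)) (at (snd c p) within ?S)"
    by (intro has_derivative_coord has_derivative_chart_diff[OF assms(1-5)])
  have "apply_bcontfun (in_chart c (snd d \<circ> g) x) i = 0" if x: "x \<in> ?S" for x
  proof -
    obtain u where u: "u \<in> fst c" "g u \<in> fst d" "x = snd c u"
      using x by auto
    have "snd d (g u) \<in> Rn (mdim N)"
      by (rule top_chart_in_Rn[OF charts_atD(1)[OF assms(2,5)] u(2)])
    then show ?thesis
      unfolding u(3) in_chart_apply[OF charts_atD(1)[OF assms(1,4)] u(1)] using i by (simp add: Rn_def)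
  qed
  note zero = this
  have p: "snd c p \<in> ?S"
    using charts_atD(2)[OF assms(1,4)] charts_atD(2)[OF assms(2,5)] by simp
  then have 2: "((\<lambda>x. apply_bcontfun (in_chart c (snd d \<circ> g) x) i) has_derivative (\<lambda>v. 0))
      (at (snd c p) within ?S)"
    by (rule has_derivative_transform[OF _ zero has_derivative_const])
  show "apply_bcontfun (chart_diff c d g p v) i = 0"
    using has_derivative_within_unique_on_Rn[OF openin_chart_domain_image[OF assms(1-5)] p v 1 2] .
qed

text \<open>That \<open>h \<circ> g\<close> is C^2 is assumed rather than derived: the rule is
  applied only with one factor equal to \<open>id\<close>, where the assumption is
  immediate.\<close>

lemma chart_diff_compose:
  assumes "C2_manifold M" "C2_manifold N" "C2_manifold P"
    and "C2_map M N g" "C2_map N P h" "C2_map M P (h \<circ> g)"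
    and "c \<in> charts_at M p" "d \<in> charts_at N (g p)" "e \<in> charts_at P (h (g p))"
    and v: "v \<in> Rn (mdim M)"
  shows "chart_diff c e (h \<circ> g) p v = chart_diff d e h (g p) (chart_diff c d g p v)"
proof (rule chain_on_Rn[where ?D1.0 = "chart_diff c d g p" and ?D2.0 = "chart_diff d e h (g p)"
      and ?D3.0 = "chart_diff c e (h \<circ> g) p", OF _ _ _ _ v])
  note c = charts_atD[OF assms(1,7)] and d = charts_atD[OF assms(2,8)] and e = charts_atD[OF assms(3,9)]
  let ?S1 = "snd c ` (fst c \<inter> g -` fst d)" and ?S2 = "snd d ` (fst d \<inter> h -` fst e)"
    and ?S3 = "snd c ` (fst c \<inter> (h \<circ> g) -` fst e)"
  show "openin (top_of_set (Rn (mdim M))) ?S1" "openin (top_of_set (Rn (mdim M))) ?S3"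
    by (rule openin_chart_domain_image[OF assms(1,2,4,7,8)] openin_chart_domain_image[OF assms(1,3,6,7,9)])+
  show "snd c p \<in> ?S1" "snd c p \<in> ?S3"
    using c d e by auto
  show "(in_chart c (snd d \<circ> g) has_derivative chart_diff c d g p) (at (snd c p) within ?S1)"
    by (rule has_derivative_chart_diff[OF assms(1,2,4,7,8)])
  show "(in_chart c (snd e \<circ> (h \<circ> g)) has_derivative chart_diff c e (h \<circ> g) p) (at (snd c p) within ?S3)"
    using has_derivative_chart_diff[OF assms(1,3,6,7), of e] assms(9) by simp
  show "(in_chart d (snd e \<circ> h) has_derivative chart_diff d e h (g p))
      (at (in_chart c (snd d \<circ> g) (snd c p)) within ?S2)"
    unfolding in_chart_apply[OF c(1,2)] using has_derivative_chart_diff[OF assms(2,3,5,8,9)] by simp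
  fix y assume "y \<in> ?S1" "y \<in> ?S3"
  then obtain u u' where u: "u \<in> fst c" "g u \<in> fst d" "y = snd c u"
    and u': "u' \<in> fst c" "h (g u') \<in> fst e" "y = snd c u'"
    by auto
  have "u' = u"
    by (rule inj_onD[OF top_chart_inj_on[OF c(1)] _ u'(1) u(1)]) (simp flip: u(3) u'(3))
  with u'(2) show "in_chart c (snd d \<circ> g) y \<in> ?S2 \<and>
      in_chart c (snd e \<circ> (h \<circ> g)) y = in_chart d (snd e \<circ> h) (in_chart c (snd d \<circ> g) y)"
    unfolding u(3) in_chart_apply[OF c(1) u(1)] using u(2) in_chart_apply[OF d(1) u(2), of "snd e \<circ> h"] by auto
qed

lemma C2_map_id:
  assumes "C2_manifold M"
  shows "C2_map M M id"
proof -
  have "id -` X = X" for X :: "'a set"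
    by auto
  then show ?thesis
    using assms unfolding C2_map_def C2_manifold_def C2_compatible_def by simp
qed

lemma chart_diff_id:
  assumes "C2_manifold M" "c \<in> charts_at M p" "v \<in> Rn (mdim M)"
  shows "chart_diff c c id p v = v"
proof -
  note c = charts_atD[OF assms(1,2)]
  let ?S = "snd c ` (fst c \<inter> id -` fst c)"
  have "(in_chart c (snd c \<circ> id) has_derivative (\<lambda>x. x)) (at (snd c p) within ?S)"
    by (rule has_derivative_transform[where f="\<lambda>x. x"])
      (use c in \<open>auto simp: inv_into_f_f top_chart_inj_on\<close>)
  moreover have "(in_chart c (snd c \<circ> id) has_derivative chart_diff c c id p) (at (snd c p) within ?S)"
    using has_derivative_chart_diff[OF assms(1,1) C2_map_id[OF assms(1)] assms(2), of c] assms(2) by simp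
  moreover have "snd c p \<in> ?S"
    using c by simp
  ultimately show ?thesis
    using has_derivative_within_unique_on_Rn[OF
        openin_chart_domain_image[OF assms(1,1) C2_map_id[OF assms(1)] assms(2,2)] _ assms(3)]
    by blast
qed

section \<open>Tangent vectors\<close>

lemma tangent_space_iff:
  "v \<in> tangent_space M p \<longleftrightarrow>
     (\<forall>c\<in>charts_at M p. v c \<in> Rn (mdim M)) \<and>
     (\<forall>c\<in>charts_at M p. \<forall>d\<in>charts_at M p. v d = chart_diff c d id p (v c)) \<and>
     (\<forall>c. c \<notin> charts_at M p \<longrightarrow> v c = 0)"
proof -
  have "id -` X = X" for X :: "'a set"
    by auto
  then show ?thesis
    by (simp add: tangent_space_def chart_diff_def)
qed

lemma tangent_spaceD:
  assumes "v \<in> tangent_space M p"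
  shows "c \<in> charts_at M p \<Longrightarrow> v c \<in> Rn (mdim M)"
    and "c \<in> charts_at M p \<Longrightarrow> d \<in> charts_at M p \<Longrightarrow> v d = chart_diff c d id p (v c)"
    and "c \<notin> charts_at M p \<Longrightarrow> v c = 0"
  using assms unfolding tangent_space_iff by blast+

lemma tangent_space_add:
  assumes "C2_manifold M" "v \<in> tangent_space M p" "w \<in> tangent_space M p"
  shows "(\<lambda>c. v c + w c) \<in> tangent_space M p"
  unfolding tangent_space_iff
proof (intro conjI ballI allI impI)
  fix c d assume c: "c \<in> charts_at M p" and d: "d \<in> charts_at M p"
  have "linear (chart_diff c d id p)"
    using linear_chart_diff C2_map_id assms(1) c d by fastforce
  then show "v d + w d = chart_diff c d id p (v c + w c)"
    using tangent_spaceD(2)[OF assms(2) c d] tangent_spaceD(2)[OF assms(3) c d] by (simp add: linear_add)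
qed (use tangent_spaceD(1,3)[OF assms(2)] tangent_spaceD(1,3)[OF assms(3)] in
    \<open>simp_all add: subspace_add subspace_Rn\<close>)

lemma tangent_space_scale:
  assumes "C2_manifold M" "v \<in> tangent_space M p"
  shows "(\<lambda>c. a *\<^sub>R v c) \<in> tangent_space M p"
  unfolding tangent_space_iff
proof (intro conjI ballI allI impI)
  fix c d assume c: "c \<in> charts_at M p" and d: "d \<in> charts_at M p"
  have "linear (chart_diff c d id p)"
    using linear_chart_diff C2_map_id assms(1) c d by fastforce
  then show "a *\<^sub>R v d = chart_diff c d id p (a *\<^sub>R v c)"
    using tangent_spaceD(2)[OF assms(2) c d] by (simp add: linear_scale)
qed (use tangent_spaceD(1,3)[OF assms(2)] in \<open>simp_all add: subspace_scale subspace_Rn\<close>)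

text \<open>A coordinate vector in a single chart determines the whole family. With
  \<open>g = id\<close> this produces tangent vectors with prescribed coordinates, in general the
  values of the tangent map.\<close>

lemma pushforward_in_tangent_space:
  assumes "C2_manifold M" "C2_manifold N" "C2_map M N g" "c \<in> charts_at M p" "x \<in> Rn (mdim M)"
  shows "(\<lambda>d. if d \<in> charts_at N (g p) then chart_diff c d g p x else 0) \<in> tangent_space N (g p)"
  unfolding tangent_space_iff
proof (intro conjI ballI)
  fix d e assume d: "d \<in> charts_at N (g p)" and e: "e \<in> charts_at N (g p)"
  have "chart_diff c e g p x = chart_diff d e id (g p) (chart_diff c d g p x)"
    using chart_diff_compose[OF assms(1,2,2,3) C2_map_id[OF assms(2)] _ assms(4) d _ assms(5), of e]
      assms(3) e by (simp only: id_comp id_apply)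
  then show "(if e \<in> charts_at N (g p) then chart_diff c e g p x else 0) =
      chart_diff d e id (g p) (if d \<in> charts_at N (g p) then chart_diff c d g p x else 0)"
    using d e by simp
qed (use chart_diff_in_Rn[OF assms(1-4) _ assms(5)] in simp_all)

lemma tangent_vector_with_coordinates:
  assumes "C2_manifold M" "c \<in> charts_at M p" "x \<in> Rn (mdim M)"
  shows "\<exists>v\<in>tangent_space M p. v c = x"
  using pushforward_in_tangent_space[OF assms(1,1) C2_map_id assms(2,3)] chart_diff_id[OF assms] assms
  by (intro bexI[of _ "\<lambda>d. if d \<in> charts_at M p then chart_diff c d id p x else 0"]) auto

text \<open>The definite description is justified: the pushforward from one chart exists, the chain
  rule with \<open>id\<close> makes it independent of that chart, and two solutions agree in the
  charts at \<open>g p\<close> and vanish elsewhere.\<close>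

lemma tangent_map:
  assumes "C2_manifold M" "C2_manifold N" "C2_map M N g" "p \<in> topspace (mtop M)"
    and v: "v \<in> tangent_space M p"
  shows "tangent_map M N g p v \<in> tangent_space N (g p)"
    and "c \<in> charts_at M p \<Longrightarrow> d \<in> charts_at N (g p) \<Longrightarrow>
      tangent_map M N g p v d = chart_diff c d g p (v c)"
proof -
  let ?P = "\<lambda>w. w \<in> tangent_space N (g p) \<and>
     (\<forall>c\<in>charts_at M p. \<forall>d\<in>charts_at N (g p). w d = chart_diff c d g p (v c))"
  obtain c where c: "c \<in> charts_at M p"
    using charts_at_nonempty[OF assms(1,4)] by blast
  let ?w = "\<lambda>d. if d \<in> charts_at N (g p) then chart_diff c d g p (v c) else 0"
  have "?P ?w"
  proof (intro conjI ballI)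
    show "?w \<in> tangent_space N (g p)"
      by (rule pushforward_in_tangent_space[OF assms(1-3) c tangent_spaceD(1)[OF v c]])
    fix c' d assume c': "c' \<in> charts_at M p" and d: "d \<in> charts_at N (g p)"
    have "chart_diff c d g p (v c) = chart_diff c' d g p (chart_diff c c' id p (v c))"
      using chart_diff_compose[OF assms(1,1,2) C2_map_id[OF assms(1)] assms(3), of c p c' d "v c"]
        assms c c' d tangent_spaceD(1)[OF v] by simp
    then show "?w d = chart_diff c' d g p (v c')"
      using tangent_spaceD(2)[OF v c c'] d by simp
  qed
  moreover have "w = ?w" if w: "?P w" for w
  proof
    show "w d = ?w d" for d
      using w c tangent_spaceD(3)[of w N "g p" d] by simp
  qed
  ultimately have "?P (THE w. ?P w)"
    by (rule theI)
  moreover have "tangent_map M N g p v = (THE w. ?P w)"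
    by (simp add: tangent_map_def chart_diff_def)
  ultimately show "tangent_map M N g p v \<in> tangent_space N (g p)"
    and "c \<in> charts_at M p \<Longrightarrow> d \<in> charts_at N (g p) \<Longrightarrow>
      tangent_map M N g p v d = chart_diff c d g p (v c)" for c
    by simp_all
qed

text \<open>All charts give the same number by the chain rule, because \<open>f\<close> in the chart
  \<open>c\<close> is \<open>f\<close> in the chart \<open>d\<close> after the transition. Hence the
  definite description may be evaluated in any chart.\<close>

lemma differential:
  assumes "C2_manifold M" "C2_function M f" and v: "v \<in> tangent_space M p"
    and c: "c \<in> charts_at M p"
  shows "differential M f p v = frechet_derivative (in_chart c f) (at (snd c p) within snd c ` fst c) (v c)"
proof -
  let ?D = "\<lambda>c. frechet_derivative (in_chart c f) (at (snd c p) within snd c ` fst c)"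
  have D: "(in_chart c f has_derivative ?D c) (at (snd c p) within snd c ` fst c)"
    if "c \<in> charts_at M p" for c
  proof (rule has_frechet_derivative_Ck_on_2)
    show "Ck_on 2 (mdim M) (snd c ` fst c) (in_chart c f)"
      using assms(2) charts_atD(3)[OF assms(1) that] by (simp add: C2_function_def)
  qed (use charts_atD(2)[OF assms(1) that] in simp)
  have "?D c (v c) = ?D d (v d)" if d: "d \<in> charts_at M p" for d
    unfolding tangent_spaceD(2)[OF v c d]
  proof (rule chain_on_Rn[where ?D1.0 = "chart_diff c d id p" and ?D2.0 = "?D d" and ?D3.0 = "?D c"])
    note c' = charts_atD[OF assms(1) c] and d' = charts_atD[OF assms(1) d]
    show "openin (top_of_set (Rn (mdim M))) (snd c ` (fst c \<inter> id -` fst d))"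
      by (rule openin_chart_domain_image[OF assms(1,1) C2_map_id[OF assms(1)] c d])
    show "openin (top_of_set (Rn (mdim M))) (snd c ` fst c)"
      by (rule top_chart_openin_image[OF c'(1,4) order_refl])
    show "snd c p \<in> snd c ` (fst c \<inter> id -` fst d)" "snd c p \<in> snd c ` fst c"
      using c' d' by auto
    show "v c \<in> Rn (mdim M)"
      using tangent_spaceD(1)[OF v c] .
    show "(in_chart c (snd d \<circ> id) has_derivative chart_diff c d id p)
        (at (snd c p) within snd c ` (fst c \<inter> id -` fst d))"
      using has_derivative_chart_diff[OF assms(1,1) C2_map_id] assms c d by simp
    show "(in_chart d f has_derivative ?D d) (at (in_chart c (snd d \<circ> id) (snd c p)) within snd d ` fst d)"
      unfolding in_chart_apply[OF c'(1,2)] using D[OF d] by simp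
    show "(in_chart c f has_derivative ?D c) (at (snd c p) within snd c ` fst c)"
      using D[OF c] .
    fix y assume "y \<in> snd c ` (fst c \<inter> id -` fst d)"
    then obtain u where u: "u \<in> fst c" "u \<in> fst d" "y = snd c u"
      by auto
    then show "in_chart c (snd d \<circ> id) y \<in> snd d ` fst d \<and>
        in_chart c f y = in_chart d f (in_chart c (snd d \<circ> id) y)"
      unfolding u(3) in_chart_apply[OF c'(1) u(1)] using in_chart_apply[OF d'(1) u(2), of f] by auto
  qed
  then have "(THE r. \<forall>c\<in>charts_at M p. r = ?D c (v c)) = ?D c (v c)"
    by (intro the_equality) (use c in blast)+
  then show ?thesis
    using v by (simp add: differential_def)
qed

section \<open>The cone of inner tangent vectors\<close>

text \<open>One set with two roles: the local model of \<open>K\<close> in an adapted chart, and the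
  coordinates of inner tangent vectors in that chart.\<close>

definition corner_cone :: "nat \<Rightarrow> nat \<Rightarrow> nat \<Rightarrow> (rseq \<Rightarrow> rseq) \<Rightarrow> rseq set" where
  "corner_cone n k l A = {x \<in> Rn n. (\<forall>i. k \<le> i \<and> i < n \<longrightarrow> apply_bcontfun x i = 0) \<and>
                                (\<forall>j<l. apply_bcontfun (A x) j \<le> 0)}"

lemma corner_cone_scale:
  "linear A \<Longrightarrow> x \<in> corner_cone n k l A \<Longrightarrow> 0 \<le> t \<Longrightarrow> t *\<^sub>R x \<in> corner_cone n k l A"
  by (auto simp: corner_cone_def linear_scale subspace_scale subspace_Rn mult_nonneg_nonpos)

lemma inner_tangent_iff:
  "v \<in> inner_tangent N k K q \<longleftrightarrow> v \<in> tangent_space N q \<and>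
     (\<exists>c l A. adapted_chart N k K q c l A \<and> v c \<in> corner_cone (mdim N) k l A)"
proof -
  have "v c \<in> Rn (mdim N)" if "v \<in> tangent_space N q" "adapted_chart N k K q c l A" for c l A
    using that tangent_spaceD(1)[of v N q c] by (simp add: adapted_chart_def)
  then show ?thesis
    unfolding inner_tangent_def corner_cone_def by blast
qed

text \<open>
  Only the rows i < l and k \<le> i < n describe constraints; as l \<le> k, they can share one index.
\<close>

definition constraint_row :: "nat \<Rightarrow> nat \<Rightarrow> (rseq \<Rightarrow> rseq) \<Rightarrow> nat \<Rightarrow> rseq \<Rightarrow> real" where
  "constraint_row n k A i x =
     (\<Sum>t<n. apply_bcontfun x t * (if i < k then apply_bcontfun (A (unit_seq t)) i else of_bool (t = i)))"

text \<open>The linear map \<open>A\<close> may be discontinuous on the infinite-dimensional space.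
  The finite sum over unit sequences replaces it by a bounded functional with the same values on
  \<open>Rn n\<close>.\<close>

lemma bounded_linear_constraint_row: "bounded_linear (constraint_row n k A i)"
  unfolding constraint_row_def[abs_def]
  by (intro bounded_linear_sum bounded_linear_mult_const bounded_linear_coord)

lemma constraint_row_eq:
  assumes "linear A" "x \<in> Rn n"
  shows "constraint_row n k A i x = (if i < k then apply_bcontfun (A x) i else apply_bcontfun x i)"
proof (cases "i < k")
  case True
  then show ?thesis
    by (simp add: constraint_row_def linear_on_Rn[OF assms] coord_sum)
next
  case False
  have "apply_bcontfun x i = apply_bcontfun (\<Sum>t<n. apply_bcontfun x t *\<^sub>R unit_seq t) i"
    using Rn_expansion[OF assms(2)] by (rule arg_cong)
  also have "\<dots> = (\<Sum>t<n. apply_bcontfun x t * of_bool (t = i))"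
    unfolding coord_sum by (intro sum.cong) auto
  finally show ?thesis
    by (simp only: constraint_row_def False if_False)
qed

lemma corner_cone_iff:
  assumes "linear A" "l \<le> k" "x \<in> Rn n"
  shows "x \<in> corner_cone n k l A \<longleftrightarrow>
    (\<forall>i\<in>{k..<n}. constraint_row n k A i x = 0) \<and> (\<forall>i<l. constraint_row n k A i x \<le> 0)"
  using assms by (auto simp: corner_cone_def constraint_row_eq)

lemma adapted_chartD:
  assumes "adapted_chart N k K q c l A"
  shows "c \<in> charts_at N q" "snd c q = 0" "l \<le> k" "linear A" "A ` Rn k = Rn l"
  using assms by (simp_all add: adapted_chart_def)

lemma adapted_chart_mem_iff:
  assumes "C2_manifold N" "adapted_chart N k K q c l A" "u \<in> fst c"
  shows "u \<in> K \<longleftrightarrow> snd c u \<in> corner_cone (mdim N) k l A"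
proof -
  note c = charts_atD[OF assms(1) adapted_chartD(1)[OF assms(2)]]
  have "snd c ` (K \<inter> fst c) =
       {x \<in> snd c ` fst c. (\<forall>i. k \<le> i \<and> i < mdim N \<longrightarrow> apply_bcontfun x i = 0) \<and>
                           (\<forall>j<l. apply_bcontfun (A x) j \<le> 0)}"
    using assms(2) by (simp add: adapted_chart_def)
  then have "snd c u \<in> snd c ` (K \<inter> fst c) \<longleftrightarrow> snd c u \<in> corner_cone (mdim N) k l A"
    using assms(3) top_chart_in_Rn[OF c(1) assms(3)] by (simp add: corner_cone_def)
  moreover have "snd c u \<in> snd c ` (K \<inter> fst c) \<longleftrightarrow> u \<in> K"
    using inj_on_image_mem_iff[OF top_chart_inj_on[OF c(1)] assms(3), of "K \<inter> fst c"] assms(3) by simp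
  ultimately show ?thesis
    by simp
qed

text \<open>
  The ray in direction x runs in K, so its image in the chart d is a curve on which \<psi> is nonpositive.
\<close>

lemma transition_of_corner_cone_direction:
  assumes N: "C2_manifold N" and c: "adapted_chart N k K q c l A"
    and d: "d \<in> charts_at N q" "snd d q = 0" and x: "x \<in> corner_cone (mdim N) k l A"
    and \<psi>: "bounded_linear \<psi>" and le: "\<And>u. u \<in> K \<Longrightarrow> u \<in> fst d \<Longrightarrow> \<psi> (snd d u) \<le> (0::real)"
  shows "\<psi> (chart_diff c d id q x) \<le> 0"
proof (rule ccontr)
  assume pos: "\<not> ?thesis"
  note ad = adapted_chartD[OF c]
  note cc = charts_atD[OF N ad(1)] and dd = charts_atD[OF N d(1)]
  let ?L = "in_chart c (snd d \<circ> id)" and ?S = "snd c ` (fst c \<inter> id -` fst d)"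
    and ?D = "chart_diff c d id q"
  obtain T where T: "open T" "?S = Rn (mdim N) \<inter> T"
    using openin_chart_domain_image[OF N N C2_map_id[OF N] ad(1) d(1)] by (auto simp: openin_open)
  define U where "U = (\<lambda>t::real. t *\<^sub>R x) -` T"
  have U: "open U"
    unfolding U_def by (intro open_vimage T continuous_intros)
  have "0 \<in> ?S"
    using cc dd ad(2) by force
  then have U0: "0 \<in> U"
    using T by (simp add: U_def)
  have xR: "t *\<^sub>R x \<in> Rn (mdim N)" for t
    using x by (simp add: corner_cone_def subspace_scale subspace_Rn)
  have img: "(\<lambda>t. t *\<^sub>R x) ` U \<subseteq> ?S"
    using T xR by (auto simp: U_def)
  have D: "(?L has_derivative ?D) (at 0 within ?S)"
    using has_derivative_chart_diff[OF N N C2_map_id[OF N] ad(1), of d] d(1) ad(2) by simp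
  have "((\<lambda>t. t *\<^sub>R x) has_derivative (\<lambda>t. t *\<^sub>R x)) (at 0 within U)"
    by (auto intro!: derivative_eq_intros)
  moreover have "(?L has_derivative ?D) (at (0 *\<^sub>R x) within (\<lambda>t. t *\<^sub>R x) ` U)"
    using has_derivative_subset[OF D img] by simp
  ultimately have "((\<lambda>t. ?L (t *\<^sub>R x)) has_derivative (\<lambda>t. ?D (t *\<^sub>R x))) (at 0 within U)"
    by (rule has_derivative_in_compose)
  from bounded_linear.has_derivative[OF \<psi> this]
  have "((\<lambda>t. \<psi> (?L (t *\<^sub>R x))) has_derivative (\<lambda>t. \<psi> (?D (t *\<^sub>R x)))) (at 0)"
    unfolding at_within_open[OF U0 U] .
  moreover have "(\<lambda>t. \<psi> (?D (t *\<^sub>R x))) = (*) (\<psi> (?D x))"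
    using linear_scale[OF has_derivative_linear[OF D]] linear_scale[OF bounded_linear.linear[OF \<psi>]]
    by (auto simp: mult.commute)
  ultimately have "((\<lambda>t. \<psi> (?L (t *\<^sub>R x))) has_real_derivative \<psi> (?D x)) (at 0)"
    by (simp add: has_field_derivative_def)
  then obtain \<delta> where \<delta>: "0 < \<delta>" "\<And>t. 0 < t \<Longrightarrow> t < \<delta> \<Longrightarrow> \<psi> (?L (0 *\<^sub>R x)) < \<psi> (?L ((0 + t) *\<^sub>R x))"
    using DERIV_pos_inc_right pos by (metis (no_types, lifting) not_le)
  obtain \<epsilon> where \<epsilon>: "0 < \<epsilon>" "ball 0 \<epsilon> \<subseteq> U"
    using U U0 open_contains_ball by blast
  \<comment> \<open>Small enough for the strict increase and for the overlap of the charts; being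
    positive, it keeps \<open>t *\<^sub>R x\<close> in the cone and hence the corresponding point in
    \<open>K\<close>.\<close>
  define t where "t = min \<delta> \<epsilon> / 2"
  have t: "0 < t" "t < \<delta>" "t \<in> ball 0 \<epsilon>"
    using \<delta>(1) \<epsilon>(1) by (auto simp: t_def)
  then have "t *\<^sub>R x \<in> ?S"
    using img \<epsilon>(2) by blast
  then obtain u where u: "u \<in> fst c" "u \<in> fst d" "t *\<^sub>R x = snd c u"
    by auto
  then have "u \<in> K"
    using adapted_chart_mem_iff[OF N c u(1)] corner_cone_scale[OF ad(4) x, of t] t(1) by simp
  moreover have "?L (t *\<^sub>R x) = snd d u"
    unfolding u(3) in_chart_apply[OF cc(1) u(1)] by simp
  moreover have "?L (snd c q) = snd d q"
    unfolding in_chart_apply[OF cc(1,2)] by simp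
  ultimately show False
    using \<delta>(2)[OF t(1,2)] le[of u] u(2) ad(2) d(2) linear_0[OF bounded_linear.linear[OF \<psi>]] by simp
qed

text \<open>The existential chart in \<open>inner_tangent\<close> becomes an arbitrary one. The cone
  is an intersection of half-spaces, and each bounding functional is nonpositive on \<open>K\<close>
  in the chart \<open>d\<close>, hence on the transported vector.\<close>

lemma inner_tangent_in_adapted_chart:
  assumes N: "C2_manifold N" and d: "adapted_chart N k K q d l A" and v: "v \<in> inner_tangent N k K q"
  shows "v d \<in> corner_cone (mdim N) k l A"
proof -
  obtain c l' A' where c: "adapted_chart N k K q c l' A'" and x: "v c \<in> corner_cone (mdim N) k l' A'"
    and vT: "v \<in> tangent_space N q"
    using v by (auto simp: inner_tangent_iff)
  note ad = adapted_chartD[OF d]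
  have vd: "v d = chart_diff c d id q (v c)"
    by (rule tangent_spaceD(2)[OF vT adapted_chartD(1)[OF c] ad(1)])
  have key: "\<psi> (v d) \<le> 0"
    if "bounded_linear \<psi>" "\<And>y. y \<in> corner_cone (mdim N) k l A \<Longrightarrow> \<psi> y \<le> 0" for \<psi> :: "rseq \<Rightarrow> real"
    unfolding vd
  proof (rule transition_of_corner_cone_direction[OF N c ad(1,2) x that(1)])
    show "\<psi> (snd d u) \<le> 0" if "u \<in> K" "u \<in> fst d" for u
      using \<open>\<And>y. y \<in> corner_cone (mdim N) k l A \<Longrightarrow> \<psi> y \<le> 0\<close> adapted_chart_mem_iff[OF N d] that
      by blast
  qed
  let ?row = "constraint_row (mdim N) k A"
  have cone: "y \<in> corner_cone (mdim N) k l A \<Longrightarrow> y \<in> Rn (mdim N)" for y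
    by (simp add: corner_cone_def)
  have le: "?row i y \<le> 0" if "i < l" "y \<in> corner_cone (mdim N) k l A" for i y
    using that corner_cone_iff[OF ad(4,3) cone] by blast
  have eq: "?row i y = 0" if "i \<in> {k..<mdim N}" "y \<in> corner_cone (mdim N) k l A" for i y
    using that corner_cone_iff[OF ad(4,3) cone] by blast
  have "?row i (v d) \<le> 0" if "i < l" for i
    using key[OF bounded_linear_constraint_row le[OF that]] .
  \<comment> \<open>An equality is a pair of inequalities, so \<open>key\<close> is applied to the
    row and to its negative.\<close>
  moreover have "?row i (v d) = 0" if "i \<in> {k..<mdim N}" for i
    using key[OF bounded_linear_constraint_row eq_refl[OF eq[OF that]]]
      key[OF bounded_linear_minus[OF bounded_linear_constraint_row], of "mdim N" k A i] eq[OF that]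
    by fastforce
  moreover have "v d \<in> Rn (mdim N)"
    by (rule tangent_spaceD(1)[OF vT ad(1)])
  ultimately show ?thesis
    using corner_cone_iff[OF ad(4,3)] by blast
qed

section \<open>Lagrange multipliers\<close>

text \<open>This expresses ZKRCQ in one fixed pair of charts, whatever adapted chart witnesses the
  inner tangent vector.\<close>

lemma ZKRCQ_decomposition:
  assumes "C2_manifold M" "C2_manifold N" "C2_map M N g" "p \<in> topspace (mtop M)"
    and ZK: "ZKRCQ M N g k K p" and d: "adapted_chart N k K (g p) d l A"
    and c: "c \<in> charts_at M p" and y: "y \<in> Rn (mdim N)"
  obtains v z where "v \<in> Rn (mdim M)" "z \<in> corner_cone (mdim N) k l A" "y = chart_diff c d g p v - z"
proof -
  note ad = adapted_chartD[OF d]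
  obtain w where w: "w \<in> tangent_space N (g p)" "w d = y"
    using tangent_vector_with_coordinates[OF assms(2) ad(1) y] by blast
  then have "w \<in> tvec_set_minus (tangent_map M N g p ` tangent_space M p) (inner_tangent N k K (g p))"
    using ZK by (simp add: ZKRCQ_def)
  then obtain v s where v: "v \<in> tangent_space M p" and s: "s \<in> inner_tangent N k K (g p)"
    and eq: "w = (\<lambda>c. tangent_map M N g p v c - s c)"
    unfolding tvec_set_minus_def by blast
  show thesis
  proof (rule that)
    show "v c \<in> Rn (mdim M)"
      by (rule tangent_spaceD(1)[OF v c])
    show "s d \<in> corner_cone (mdim N) k l A"
      by (rule inner_tangent_in_adapted_chart[OF assms(2) d s])
    show "y = chart_diff c d g p (v c) - s d"
      using w(2) tangent_map(2)[OF assms(1-4) v c ad(1)] by (simp add: eq)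
  qed
qed

text \<open>Once ZKRCQ has forced the form with coefficients \<open>b\<close> to vanish, linear
  independence of the rows forces the coefficients to vanish too. For a Fritz John multiplier with
  zero objective weight this contradicts the normalization.\<close>

lemma nontrivial_multiplier_excluded:
  assumes "C2_manifold M" "C2_manifold N" "C2_map M N g" "p \<in> topspace (mtop M)" "k \<le> mdim N"
    and "ZKRCQ M N g k K p" and d: "adapted_chart N k K (g p) d l A"
    and c: "c \<in> charts_at M p"
    and nonneg: "\<And>i. i < l \<Longrightarrow> 0 \<le> b i"
    and zero: "\<And>v. v \<in> Rn (mdim M) \<Longrightarrow>
      (\<Sum>i\<in>{..<l} \<union> {k..<mdim N}. b i * constraint_row (mdim N) k A i (chart_diff c d g p v)) = 0"
    and i: "i \<in> {..<l} \<union> {k..<mdim N}"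
  shows "b i = 0"
proof -
  let ?n = "mdim N" and ?row = "constraint_row (mdim N) k A" and ?I = "{..<l} \<union> {k..<mdim N}"
  note ad = adapted_chartD[OF d]
  define \<nu> where "\<nu> y = (\<Sum>i\<in>?I. b i * ?row i y)" for y
  have lin: "linear \<nu>"
    unfolding \<nu>_def[abs_def]
    by (intro bounded_linear.linear bounded_linear_sum bounded_linear_const_mult bounded_linear_constraint_row)
  have le: "\<nu> z \<le> 0" if z: "z \<in> corner_cone ?n k l A" for z
    unfolding \<nu>_def
  proof (rule sum_nonpos)
    fix i assume i: "i \<in> ?I"
    have "z \<in> Rn ?n"
      using z by (simp add: corner_cone_def)
    then have "(i < l \<longrightarrow> ?row i z \<le> 0) \<and> (\<not> i < l \<longrightarrow> ?row i z = 0)"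
      using z i corner_cone_iff[OF ad(4,3)] by auto
    then show "b i * ?row i z \<le> 0"
      using nonneg[of i] by (cases "i < l") (simp_all add: mult_nonneg_nonpos)
  qed
  have ge: "0 \<le> \<nu> y" if y: "y \<in> Rn ?n" for y
  proof -
    obtain v z where vz: "v \<in> Rn (mdim M)" "z \<in> corner_cone ?n k l A" "y = chart_diff c d g p v - z"
      using ZKRCQ_decomposition[OF assms(1-4,6) d c y] .
    then show ?thesis
      using zero[OF vz(1)] le[OF vz(2)] linear_diff[OF lin] by (simp add: \<nu>_def)
  qed
  have \<nu>0: "\<nu> y = 0" if y: "y \<in> Rn ?n" for y
    using ge[OF y] ge[OF subspace_neg[OF subspace_Rn y]] linear_neg[OF lin, of y] by simp
  \<comment> \<open>Surjectivity on \<open>Rn k\<close> provides a vector on which row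
    \<open>j\<close> is 1 and all other rows are 0, since its coordinates from \<open>k\<close> on
    vanish.\<close>
  have small: "b j = 0" if j: "j < l" for j
  proof -
    have "unit_seq j \<in> A ` Rn k"
      using j ad(5) by simp
    then obtain y where y: "y \<in> Rn k" "A y = unit_seq j"
      by force
    have yn: "y \<in> Rn ?n"
      using y(1) Rn_mono[OF assms(5)] by blast
    have "?row i y = of_bool (i = j)" if "i \<in> ?I" for i
      using that y ad(3) j constraint_row_eq[OF ad(4) yn, of k i] by (auto simp: Rn_def)
    then have "\<nu> y = (\<Sum>i\<in>?I. b i * of_bool (i = j))"
      by (simp add: \<nu>_def)
    also have "\<dots> = b j"
      using j by (simp add: of_bool_def if_distrib sum.delta cong: if_cong)
    finally show ?thesis
      using \<nu>0[OF yn] by simp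
  qed
  show ?thesis
  proof (cases "i < l")
    case False
    then have i': "i \<in> {k..<?n}"
      using i by simp
    then have un: "unit_seq i \<in> Rn ?n"
      by simp
    \<comment> \<open>\<open>A\<close> is unrestricted on \<open>unit_seq i\<close> for
      \<open>k \<le> i\<close>, so the inequality rows may be nonzero there. They drop out because
      their coefficients are already known to be 0.\<close>
    have "b j * ?row j (unit_seq i) = b j * of_bool (j = i)" if "j \<in> ?I" for j
      using that i' small[of j] ad(3) constraint_row_eq[OF ad(4) un, of k j] by (cases "j < l") auto
    then have "\<nu> (unit_seq i) = (\<Sum>j\<in>?I. b j * of_bool (j = i))"
      unfolding \<nu>_def by (intro sum.cong refl)
    also have "\<dots> = b i"
      using i' by (simp add: of_bool_def if_distrib sum.delta cong: if_cong)
    finally show ?thesis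
      using \<nu>0[OF un] by simp
  qed (rule small)
qed

lemma multipliers_nonempty:
  assumes M: "C2_manifold M" and N: "C2_manifold N"
    and K: "submanifold_with_corners N k K"
    and f: "C2_function M f" and g: "C2_map M N g"
    and min: "local_minimizer M f (feasible_set M g K) p"
    and ZK: "ZKRCQ M N g k K p"
  shows "multipliers M N f g k K p \<noteq> {}"
proof -
  obtain W where W: "openin (mtop M) W" "p \<in> W" "\<And>q. q \<in> W \<Longrightarrow> q \<in> feasible_set M g K \<Longrightarrow> f p \<le> f q"
    and p: "p \<in> topspace (mtop M)" "g p \<in> K"
    using min by (auto simp: local_minimizer_def feasible_set_def)
  obtain d l A where d: "adapted_chart N k K (g p) d l A"
    using K p(2) by (auto simp: submanifold_with_corners_def)
  obtain c where c: "c \<in> charts_at M p"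
    using charts_at_nonempty[OF M p(1)] by blast
  note ad = adapted_chartD[OF d]
  note cc = charts_atD[OF M c] and dd = charts_atD[OF N ad(1)]
  let ?m = "mdim M" and ?n = "mdim N" and ?I = "{..<l} \<union> {k..<mdim N}"
    and ?row = "constraint_row (mdim N) k A" and ?G = "in_chart c (snd d \<circ> g)"
  let ?S0 = "snd c ` (fst c \<inter> g -` fst d)"
  have kn: "k \<le> ?n"
    using K by (simp add: submanifold_with_corners_def)
  \<comment> \<open>Intersecting with \<open>W\<close> makes the local minimizer a minimizer over
    all feasible points represented in \<open>S\<close>.\<close>
  define S where "S = snd c ` (fst c \<inter> g -` fst d \<inter> W)"
  have S: "openin (top_of_set (Rn ?m)) S"
    unfolding S_def using openin_Int[OF openin_chart_domain[OF M N g c ad(1)] W(1)]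
    by (intro top_chart_openin_image[OF cc(1)]) auto
  have x0: "snd c p \<in> S"
    using cc(2) dd(2) W(2) by (simp add: S_def)
  have sub: "S \<subseteq> snd c ` fst c" "S \<subseteq> ?S0"
    by (auto simp: S_def)
  have "Ck_on 2 ?m (snd c ` fst c) (in_chart c f)"
    using f cc(3) by (simp add: C2_function_def)
  then obtain F' where F0: "\<And>x. x \<in> snd c ` fst c \<Longrightarrow> (in_chart c f has_derivative F' x) (at x within snd c ` fst c)"
    and F'_cont: "\<And>v. v \<in> Rn ?m \<Longrightarrow> continuous_on (snd c ` fst c) (\<lambda>x. F' x v)"
    by (rule Ck_on_2E) blast
  have "Ck_on 2 ?m ?S0 ?G"
    using g cc(3) dd(3) by (simp add: C2_map_def)
  then obtain G' where G0: "\<And>x. x \<in> ?S0 \<Longrightarrow> (?G has_derivative G' x) (at x within ?S0)"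
    and G'_cont: "\<And>v. v \<in> Rn ?m \<Longrightarrow> continuous_on ?S0 (\<lambda>x. G' x v)"
    by (rule Ck_on_2E) blast
  have G_S: "\<exists>u. x = snd c u \<and> u \<in> fst c \<and> g u \<in> fst d \<and> u \<in> W \<and> ?G x = snd d (g u)
      \<and> in_chart c f x = f u" if "x \<in> S" for x
  proof -
    obtain u where u: "u \<in> fst c" "g u \<in> fst d" "u \<in> W" "x = snd c u"
      using \<open>x \<in> S\<close> by (auto simp: S_def)
    have "?G x = snd d (g u)"
      unfolding u(4) in_chart_apply[OF cc(1) u(1)] by simp
    moreover have "in_chart c f x = f u"
      unfolding u(4) by (rule in_chart_apply[OF cc(1) u(1)])
    ultimately show ?thesis
      using u by blast
  qed
  have Gp: "?G (snd c p) = 0"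
    unfolding in_chart_apply[OF cc(1,2)] using ad(2) by simp
  \<comment> \<open>The coordinate rows are the equality constraints. All rows vanish at
    \<open>snd c p\<close> because the adapted chart is centered at \<open>g p\<close>.\<close>
  obtain a b where ab: "0 \<le> a" "\<And>i. i \<in> ?I - {k..<?n} \<Longrightarrow> 0 \<le> b i" "a + (\<Sum>i\<in>?I. \<bar>b i\<bar>) = 1"
    "\<And>v. v \<in> Rn ?m \<Longrightarrow> a * F' (snd c p) v + (\<Sum>i\<in>?I. b i * ?row i (G' (snd c p) v)) = 0"
  proof (rule fritz_john_on_Rn[OF S x0, where I="?I" and E="{k..<?n}" and F="in_chart c f" and F'=F'
        and h="\<lambda>i x. ?row i (?G x)" and h'="\<lambda>i x v. ?row i (G' x v)"])
    show "(in_chart c f has_derivative F' x) (at x within S)" if "x \<in> S" for x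
      using has_derivative_subset[OF F0 sub(1)] that sub(1) by blast
    show "continuous_on S (\<lambda>x. F' x v)" if "v \<in> Rn ?m" for v
      by (rule continuous_on_subset[OF F'_cont[OF that] sub(1)])
    show "((\<lambda>x. ?row i (?G x)) has_derivative (\<lambda>v. ?row i (G' x v))) (at x within S)"
      if "i \<in> ?I" "x \<in> S" for i x
      using has_derivative_subset[OF G0 sub(2)] that(2) sub(2)
      by (intro bounded_linear.has_derivative[OF bounded_linear_constraint_row]) blast
    show "continuous_on S (\<lambda>x. ?row i (G' x v))" if "i \<in> ?I" "v \<in> Rn ?m" for i v
      by (intro bounded_linear.continuous_on[OF bounded_linear_constraint_row]
          continuous_on_subset[OF G'_cont[OF that(2)] sub(2)])
    show "?row i (?G (snd c p)) = 0" for i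
      unfolding Gp by (rule linear_0[OF bounded_linear.linear[OF bounded_linear_constraint_row]])
    show "in_chart c f (snd c p) \<le> in_chart c f x"
      if x: "x \<in> S" and con: "\<forall>i\<in>?I. if i \<in> {k..<?n} then ?row i (?G x) = 0 else ?row i (?G x) \<le> 0" for x
    proof -
      obtain u where u: "u \<in> fst c" "g u \<in> fst d" "u \<in> W" "?G x = snd d (g u)" "in_chart c f x = f u"
        using G_S[OF x] by blast
      have "?G x \<in> Rn ?n"
        unfolding u(4) by (rule top_chart_in_Rn[OF dd(1) u(2)])
      moreover have "?row i (?G x) \<le> 0" if "i < l" for i
        using con[rule_format, of i] that by (auto split: if_splits)
      moreover have "?row i (?G x) = 0" if "i \<in> {k..<?n}" for i
        using con[rule_format, of i] that by simp
      ultimately have "?G x \<in> corner_cone ?n k l A"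
        using corner_cone_iff[OF ad(4,3)] by blast
      then have "g u \<in> K"
        using adapted_chart_mem_iff[OF N d u(2)] u(4) by simp
      then have "f p \<le> f u"
        using W(3)[OF u(3)] openin_subset[OF W(1)] u(3) by (auto simp: feasible_set_def)
      then show ?thesis
        unfolding u(5) in_chart_apply[OF cc(1,2)] .
    qed
  qed (simp, rule that)
  have p0: "snd c p \<in> snd c ` fst c" "snd c p \<in> ?S0"
    using x0 sub by blast+
  \<comment> \<open>\<open>F'\<close> and \<open>G'\<close> are the derivatives supplied by
    \<open>Ck_on\<close>. They are matched with those of \<open>chart_diff\<close> and
    \<open>differential\<close> in directions of \<open>Rn\<close>, the only ones in the
    stationarity condition.\<close>
  have G'_eq: "G' (snd c p) v = chart_diff c d g p v" if "v \<in> Rn ?m" for v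
    by (rule has_derivative_within_unique_on_Rn[OF openin_chart_domain_image[OF M N g c ad(1)] p0(2) that
          G0[OF p0(2)] has_derivative_chart_diff[OF M N g c ad(1)]])
  have F'_eq: "F' (snd c p) (v c) = differential M f p v" if "v \<in> tangent_space M p" for v
    unfolding differential[OF M f that c]
  proof (rule has_derivative_within_unique_on_Rn[OF _ p0(1) tangent_spaceD(1)[OF that c] F0[OF p0(1)]])
    show "openin (top_of_set (Rn ?m)) (snd c ` fst c)"
      by (rule top_chart_openin_image[OF cc(1,4) order_refl])
    show "(in_chart c f has_derivative frechet_derivative (in_chart c f) (at (snd c p) within snd c ` fst c))
        (at (snd c p) within snd c ` fst c)"
      by (rule has_frechet_derivative_Ck_on_2[OF \<open>Ck_on 2 ?m (snd c ` fst c) (in_chart c f)\<close> p0(1)])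
  qed
  have b_nonneg: "0 \<le> b i" if "i < l" for i
    using ab(2)[of i] that ad(3) by simp
  have "a \<noteq> 0"
  proof
    assume a0: "a = 0"
    have "b i = 0" if "i \<in> ?I" for i
      by (rule nontrivial_multiplier_excluded[OF M N g p(1) kn ZK d c b_nonneg _ that])
        (use ab(4) a0 G'_eq in \<open>simp_all\<close>)
    then show False
      using ab(3) a0 by simp
  qed
  define \<nu> where "\<nu> y = (\<Sum>i\<in>?I. b i * ?row i y) / a" for y
  have lin: "linear \<nu>"
    unfolding \<nu>_def[abs_def]
    by (intro bounded_linear.linear bounded_linear_divide bounded_linear_sum
        bounded_linear_compose[OF bounded_linear_divide] bounded_linear_const_mult bounded_linear_constraint_row)
  \<comment> \<open>A form on coordinates acts on a tangent vector through its representative in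
    \<open>d\<close>; the default 0 is the extension required by
    \<open>cotangent_space\<close>.\<close>
  define \<mu> where "\<mu> w = (if w \<in> tangent_space N (g p) then \<nu> (w d) else 0)" for w
  have "\<mu> \<in> cotangent_space N (g p)"
    unfolding cotangent_space_def \<mu>_def
    by (auto simp: tangent_space_add[OF N] tangent_space_scale[OF N] linear_add[OF lin] linear_scale[OF lin])
  moreover have "differential M f p v + \<mu> (tangent_map M N g p v) = 0" if v: "v \<in> tangent_space M p" for v
  proof -
    have vc: "v c \<in> Rn ?m"
      by (rule tangent_spaceD(1)[OF v c])
    have "a * differential M f p v + a * \<nu> (chart_diff c d g p (v c)) = 0"
      using ab(4)[OF vc] \<open>a \<noteq> 0\<close> by (simp add: F'_eq[OF v] G'_eq[OF vc] \<nu>_def)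
    then have "a * (differential M f p v + \<nu> (chart_diff c d g p (v c))) = 0"
      by (simp add: distrib_left)
    then show ?thesis
      using \<open>a \<noteq> 0\<close> tangent_map[OF M N g p(1) v] c ad(1) by (simp add: \<mu>_def)
  qed
  moreover have "\<mu> s \<le> 0" if s: "s \<in> inner_tangent N k K (g p)" for s
  proof -
    have sT: "s \<in> tangent_space N (g p)"
      using s by (simp add: inner_tangent_iff)
    have "s d \<in> corner_cone ?n k l A" "s d \<in> Rn ?n"
      using inner_tangent_in_adapted_chart[OF N d s] tangent_spaceD(1)[OF sT ad(1)] by auto
    then have row: "\<forall>i\<in>{k..<?n}. ?row i (s d) = 0" "\<forall>i<l. ?row i (s d) \<le> 0"
      using corner_cone_iff[OF ad(4,3)] by blast+
    have "(\<Sum>i\<in>?I. b i * ?row i (s d)) \<le> 0"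
    proof (rule sum_nonpos)
      fix i assume "i \<in> ?I"
      then show "b i * ?row i (s d) \<le> 0"
        using row b_nonneg[of i] by (cases "i < l") (simp_all add: mult_nonneg_nonpos)
    qed
    then show ?thesis
      using sT ab(1) by (simp add: \<mu>_def \<nu>_def divide_nonpos_nonneg)
  qed
  ultimately have "\<mu> \<in> multipliers M N f g k K p"
    by (simp add: multipliers_def polar_cone_def)
  then show ?thesis
    by blast
qed

section \<open>Compactness and uniqueness of the multipliers\<close>

lemma multipliersD:
  assumes "\<mu> \<in> multipliers M N f g k K p"
  shows "\<mu> \<in> cotangent_space N (g p)"
    and "v \<in> tangent_space M p \<Longrightarrow> \<mu> (tangent_map M N g p v) = - differential M f p v"
    and "s \<in> inner_tangent N k K (g p) \<Longrightarrow> \<mu> s \<le> 0"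
  using assms by (auto simp: multipliers_def polar_cone_def add_eq_0_iff)

lemma cotangent_diff:
  assumes "C2_manifold N" "\<mu> \<in> cotangent_space N q" "v \<in> tangent_space N q" "w \<in> tangent_space N q"
  shows "\<mu> (\<lambda>c. v c - w c) = \<mu> v - \<mu> w"
proof -
  have add: "\<forall>v\<in>tangent_space N q. \<forall>w\<in>tangent_space N q. \<mu> (\<lambda>c. v c + w c) = \<mu> v + \<mu> w"
    using assms(2) by (simp add: cotangent_space_def)
  have "\<mu> (\<lambda>c. v c + (- 1) *\<^sub>R w c) = \<mu> v + \<mu> (\<lambda>c. (- 1) *\<^sub>R w c)"
    by (rule bspec[OF bspec[OF add assms(3)] tangent_space_scale[OF assms(1,4)]])
  moreover have "\<mu> (\<lambda>c. (- 1) *\<^sub>R w c) = (- 1) * \<mu> w"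
    using assms(2,4) unfolding cotangent_space_def by blast
  ultimately show ?thesis
    by simp
qed

lemma cotangent_uminus:
  assumes "\<mu> \<in> cotangent_space N q" "v \<in> tangent_space N q"
  shows "\<mu> (\<lambda>c. - v c) = - \<mu> v"
proof -
  have "\<mu> (\<lambda>c. (- 1) *\<^sub>R v c) = (- 1) * \<mu> v"
    using assms unfolding cotangent_space_def by blast
  then show ?thesis
    by simp
qed

text \<open>Tychonoff's theorem: the function type carries the product topology, and the set is a
  product of compact intervals.\<close>

lemma compact_real_function_box:
  fixes lo hi :: "'a \<Rightarrow> real"
  shows "compact {\<mu>. \<forall>y. lo y \<le> \<mu> y \<and> \<mu> y \<le> hi y}"
proof -
  have "compactin (product_topology (\<lambda>y. euclidean) UNIV) (PiE UNIV (\<lambda>y. {lo y..hi y}))"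
    by (simp add: compactin_PiE)
  moreover have "PiE UNIV (\<lambda>y. {lo y..hi y}) = {\<mu>. \<forall>y. lo y \<le> \<mu> y \<and> \<mu> y \<le> hi y}"
    by (auto simp: PiE_def)
  ultimately show ?thesis
    by (simp add: euclidean_product_topology)
qed

lemma closed_Collect_ball: "(\<And>y. y \<in> A \<Longrightarrow> closed {x. P x y}) \<Longrightarrow> closed {x. \<forall>y\<in>A. P x y}"
  by (simp add: Collect_ball_eq closed_INT)

text \<open>Each defining condition is an equation or a weak inequality between finitely many values
  of \<open>\<mu>\<close>, and evaluation at a point is continuous for pointwise
  convergence.\<close>

lemma closed_multipliers: "closed (multipliers M N f g k K p)"
proof -
  have "multipliers M N f g k K p = {\<mu>.
     (\<forall>v\<in>tangent_space N (g p). \<forall>w\<in>tangent_space N (g p). \<mu> (\<lambda>c. v c + w c) = \<mu> v + \<mu> w) \<and>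
     (\<forall>a. \<forall>v\<in>tangent_space N (g p). \<mu> (\<lambda>c. a *\<^sub>R v c) = a * \<mu> v) \<and>
     (\<forall>v\<in>- tangent_space N (g p). \<mu> v = 0) \<and>
     (\<forall>v\<in>tangent_space M p. differential M f p v + \<mu> (tangent_map M N g p v) = 0) \<and>
     (\<forall>s\<in>inner_tangent N k K (g p). \<mu> s \<le> 0)}"
    unfolding multipliers_def polar_cone_def cotangent_space_def by blast
  moreover have "closed \<dots>"
    by (intro closed_Collect_conj closed_Collect_ball closed_Collect_all closed_Collect_eq
        closed_Collect_le continuous_intros continuous_on_product_coordinates)
  ultimately show ?thesis
    by simp
qed

lemma compact_multipliers:
  assumes M: "C2_manifold M" and N: "C2_manifold N" and g: "C2_map M N g"
    and p: "p \<in> topspace (mtop M)" and ZK: "ZKRCQ M N g k K p"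
  shows "compact (multipliers M N f g k K p)"
proof -
  let ?T = "tangent_space N (g p)" and ?\<Lambda> = "multipliers M N f g k K p"
  have "\<exists>r. \<forall>\<mu>\<in>?\<Lambda>. r \<le> \<mu> y" for y
  proof (cases "y \<in> ?T")
    case True
    then have "y \<in> tvec_set_minus (tangent_map M N g p ` tangent_space M p) (inner_tangent N k K (g p))"
      using ZK by (simp add: ZKRCQ_def)
    then obtain v s where v: "v \<in> tangent_space M p" and s: "s \<in> inner_tangent N k K (g p)"
      and eq: "y = (\<lambda>c. tangent_map M N g p v c - s c)"
      unfolding tvec_set_minus_def by blast
    have "- differential M f p v \<le> \<mu> y" if \<mu>: "\<mu> \<in> ?\<Lambda>" for \<mu>
      unfolding eq
      using cotangent_diff[OF N multipliersD(1)[OF \<mu>] tangent_map(1)[OF M N g p v], of s] s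
        multipliersD(2)[OF \<mu> v] multipliersD(3)[OF \<mu> s] by (simp add: inner_tangent_iff)
    then show ?thesis
      by blast
  next
    case False
    then have "0 \<le> \<mu> y" if "\<mu> \<in> ?\<Lambda>" for \<mu>
      using multipliersD(1)[OF that] by (simp add: cotangent_space_def)
    then show ?thesis
      by blast
  qed
  then obtain lo where lo: "\<And>\<mu> y. \<mu> \<in> ?\<Lambda> \<Longrightarrow> lo y \<le> \<mu> y"
    by metis
  \<comment> \<open>Linearity turns the lower bound at the negated vector into an upper bound. Off
    the tangent space every multiplier is 0, so 0 is an upper bound there.\<close>
  define hi where "hi y = (if y \<in> ?T then - lo (\<lambda>c. - y c) else 0)" for y
  have hi: "\<mu> y \<le> hi y" if \<mu>: "\<mu> \<in> ?\<Lambda>" for \<mu> y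
  proof (cases "y \<in> ?T")
    case True
    then show ?thesis
      using lo[OF \<mu>, of "\<lambda>c. - y c"] cotangent_uminus[OF multipliersD(1)[OF \<mu>] True] by (simp add: hi_def)
  next
    case False
    then show ?thesis
      using multipliersD(1)[OF \<mu>] by (simp add: hi_def cotangent_space_def)
  qed
  have "{\<mu>. \<forall>y. lo y \<le> \<mu> y \<and> \<mu> y \<le> hi y} \<inter> ?\<Lambda> = ?\<Lambda>"
    using lo hi by blast
  then show ?thesis
    using compact_Int_closed[OF compact_real_function_box[of lo hi] closed_multipliers[of M N f g k K p]]
    by simp
qed

lemma multipliers_unique:
  assumes M: "C2_manifold M" and N: "C2_manifold N" and g: "C2_map M N g"
    and p: "p \<in> topspace (mtop M)" and LI: "LICQ M N g k K p"
    and \<mu>: "\<mu> \<in> multipliers M N f g k K p" and \<mu>': "\<mu>' \<in> multipliers M N f g k K p"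
  shows "\<mu> = \<mu>'"
proof
  fix y
  let ?T = "tangent_space N (g p)"
  show "\<mu> y = \<mu>' y"
  proof (cases "y \<in> ?T")
    case True
    then have "y \<in> tvec_set_minus (tangent_map M N g p ` tangent_space M p) (inner_tangent0 N k K (g p))"
      using LI by (simp add: LICQ_def)
    then obtain v s where v: "v \<in> tangent_space M p" and s: "s \<in> inner_tangent0 N k K (g p)"
      and eq: "y = (\<lambda>c. tangent_map M N g p v c - s c)"
      unfolding tvec_set_minus_def by blast
    obtain c l A where c: "adapted_chart N k K (g p) c l A" and sT: "s \<in> ?T"
      and s0: "\<forall>i. k \<le> i \<and> i < mdim N \<longrightarrow> apply_bcontfun (s c) i = 0" "\<forall>j<l. apply_bcontfun (A (s c)) j = 0"
      using s unfolding inner_tangent0_def by blast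
    have "s c \<in> Rn (mdim N)"
      by (rule tangent_spaceD(1)[OF sT adapted_chartD(1)[OF c]])
    \<comment> \<open>The conditions of T^0 are equations, so the vector and its negative are both
      inner tangent vectors; polarity applied to both gives \<open>\<mu> s = 0\<close>.\<close>
    then have "s c \<in> corner_cone (mdim N) k l A" "- s c \<in> corner_cone (mdim N) k l A"
      using s0 linear_neg[OF adapted_chartD(4)[OF c], of "s c"]
      by (simp_all add: corner_cone_def subspace_neg subspace_Rn)
    moreover have "(\<lambda>c. - s c) \<in> ?T"
      using tangent_space_scale[OF N sT, of "- 1"] by simp
    ultimately have inner: "s \<in> inner_tangent N k K (g p)" "(\<lambda>c. - s c) \<in> inner_tangent N k K (g p)"
      unfolding inner_tangent_iff using sT c by blast+
    have *: "\<mu> y = - differential M f p v" if \<mu>: "\<mu> \<in> multipliers M N f g k K p" for \<mu>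
    proof -
      have "\<mu> s = 0"
        using multipliersD(3)[OF \<mu> inner(1)] multipliersD(3)[OF \<mu> inner(2)]
          cotangent_uminus[OF multipliersD(1)[OF \<mu>] sT] by simp
      then show ?thesis
        unfolding eq cotangent_diff[OF N multipliersD(1)[OF \<mu>] tangent_map(1)[OF M N g p v] sT]
        using multipliersD(2)[OF \<mu> v] by simp
    qed
    show ?thesis
      unfolding *[OF \<mu>] *[OF \<mu>'] ..
  next
    case False
    then show ?thesis
      using multipliersD(1)[OF \<mu>] multipliersD(1)[OF \<mu>'] by (simp add: cotangent_space_def)
  qed
qed

theorem theorem4p1:
  fixes M :: "'p mfd" and N :: "'q mfd" and K :: "'q set" and k :: nat
    and f :: "'p \<Rightarrow> real" and g :: "'p \<Rightarrow> 'q" and p :: 'p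
  assumes "C2_manifold M" and "C2_manifold N"
    and "submanifold_with_corners N k K"
    and "C2_function M f" and "C2_map M N g"
    and "local_minimizer M f (feasible_set M g K) p"
    and "ZKRCQ M N g k K p"
  shows "(\<exists>\<mu>. \<mu> \<in> multipliers M N f g k K p) \<and>
         compact (multipliers M N f g k K p) \<and>
         (LICQ M N g k K p \<longrightarrow> is_singleton (multipliers M N f g k K p))"
proof (intro conjI impI)
  have p: "p \<in> topspace (mtop M)"
    using assms(6) by (simp add: local_minimizer_def feasible_set_def)
  obtain \<mu> where \<mu>: "\<mu> \<in> multipliers M N f g k K p"
    using multipliers_nonempty[OF assms] by blast
  then show "\<exists>\<mu>. \<mu> \<in> multipliers M N f g k K p"
    by blast
  show "compact (multipliers M N f g k K p)"
    by (rule compact_multipliers[OF assms(1,2,5) p assms(7)])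
  assume "LICQ M N g k K p"
  then have "\<mu>' = \<mu>" if "\<mu>' \<in> multipliers M N f g k K p" for \<mu>'
    using multipliers_unique[OF assms(1,2,5) p _ that \<mu>] by blast
  then show "is_singleton (multipliers M N f g k K p)"
    using \<mu> by (intro is_singletonI') auto
qed

end
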